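(* Let $n\ge 1$ be an integer and let $\Phi$ be the $n$-dimensional Matérn cluster process with parent intensity $\lambda_{\mathrm p}>0$, daughter intensity $\lambda_{\mathrm d}>0$ and cluster radius $r_{\mathrm d}>0$. Let $R_{\mathrm N}$ be the nearest-neighbor distance, i.e. under the Palm distribution of $\Phi$ at the origin (typical point at $\mathrm o$), the distance from $\mathrm o$ to the nearest other point of $\Phi$, with CDF $F_{R_{\mathrm N}}(r)=1-\mathbb P^{!}_{\mathrm o}\big(\Phi(\mathcal B(\mathrm o,r))=0\big)$. Let $F_{R_{\mathrm C}}(r)=\mathbb P(\min_{\mathbf z\in\Phi}\|\mathbf z\|\le r)$ be the CDF of the contact distance. Then for every $r>0$, \[ F_{R_{\mathrm N}}(r)=1-\big(1-F_{R_{\mathrm C}}(r)\big)\,n\,r_{\mathrm d}^{-n}\int_0^{r_{\mathrm d}}e^{-\lambda_{\mathrm d}A(r,r_{\mathrm d},x)}x^{n-1}\,\mathrm dx . \]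
   Context: The $n$-dimensional Matérn cluster process: $\Phi_{\mathrm p}=\{\mathbf x_i\}$ is a homogeneous Poisson point process in $\mathbb R^n$ of intensity $\lambda_{\mathrm p}$; each parent $\mathbf x_i$ receives an independent daughter process $\Phi_{\mathrm d}^{(i)}$, a homogeneous Poisson point process of intensity $\lambda_{\mathrm d}$ restricted to the ball $\mathcal B(\mathrm o,r_{\mathrm d})$ centered at the origin, independent of $\Phi_{\mathrm p}$; $\Phi=\bigcup_i(\mathbf x_i+\Phi_{\mathrm d}^{(i)})$ (a stationary process). $\mathbb P^{!}_{\mathrm o}$ denotes the reduced Palm distribution at the origin. $A(r,r_{\mathrm d},x)$ is the volume of the intersection of two $n$-dimensional balls of radii $r$ and $r_{\mathrm d}$ whose centers are at distance $x$. *)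

theory Defs
  imports "HOL-Probability.Probability"
begin

definition lf_configs :: "'a::euclidean_space set set" where
  "lf_configs = {\<phi>. \<forall>B. bounded B \<longrightarrow> finite (\<phi> \<inter> B)}"

definition cfg_space :: "'a::euclidean_space set measure" where
  "cfg_space = sigma lf_configs
     {{\<phi> \<in> lf_configs. card (\<phi> \<inter> B) = k} | B k. B \<in> sets borel \<and> bounded B}"

definition poisson_pp :: "'w measure \<Rightarrow> ('w \<Rightarrow> 'a::euclidean_space set) \<Rightarrow> ('a set \<Rightarrow> real) \<Rightarrow> bool" where
  "poisson_pp M N Lam \<longleftrightarrow>
     prob_space M \<and>
     N \<in> measurable M cfg_space \<and>
     (\<forall>B k. B \<in> sets borel \<and> bounded B \<longrightarrow>
        measure M {\<omega> \<in> space M. card (N \<omega> \<inter> B) = k}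
          = exp (- Lam B) * Lam B ^ k / fact k) \<and>
     (\<forall>(I :: nat set) (Bs :: nat \<Rightarrow> 'a set).
        finite I \<and> disjoint_family_on Bs I \<and> (\<forall>i\<in>I. Bs i \<in> sets borel \<and> bounded (Bs i)) \<longrightarrow>
        prob_space.indep_vars M (\<lambda>_. count_space UNIV) (\<lambda>i \<omega>. card (N \<omega> \<inter> Bs i)) I)"

text \<open>The Matern cluster process: parents x_i (a measurable enumeration of a homogeneous
  Poisson process of intensity lp), i.i.d. daughter processes D_i (homogeneous Poisson of
  intensity ld restricted to the ball B(o, rd)), independent of the parents;
  Phi = union of x_i + D_i.\<close>

definition matern_cluster ::
  "'w measure \<Rightarrow> ('w \<Rightarrow> 'a::euclidean_space set) \<Rightarrow> real \<Rightarrow> real \<Rightarrow> real \<Rightarrow> bool" where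
  "matern_cluster M Phi lp ld rd \<longleftrightarrow>
     (\<exists>(X :: nat \<Rightarrow> 'w \<Rightarrow> 'a) (D :: nat \<Rightarrow> 'w \<Rightarrow> 'a set).
        prob_space M \<and>
        (\<forall>i. X i \<in> borel_measurable M) \<and>
        (\<forall>\<omega>\<in>space M. inj (\<lambda>i. X i \<omega>)) \<and>
        poisson_pp M (\<lambda>\<omega>. range (\<lambda>i. X i \<omega>)) (\<lambda>B. lp * measure lebesgue B) \<and>
        (\<forall>i. poisson_pp M (D i) (\<lambda>B. ld * measure lebesgue (B \<inter> ball 0 rd))) \<and>
        prob_space.indep_vars M (\<lambda>_. (cfg_space :: 'a set measure)) D UNIV \<and>
        (\<lambda>\<omega> i. X i \<omega>) \<in> measurable M (Pi\<^sub>M (UNIV :: nat set) (\<lambda>_. (borel :: 'a measure))) \<and>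
        (\<lambda>\<omega> i. D i \<omega>) \<in> measurable M (Pi\<^sub>M (UNIV :: nat set) (\<lambda>_. (cfg_space :: 'a set measure))) \<and>
        prob_space.indep_set M
          (sigma_sets (space M) {(\<lambda>\<omega> i. X i \<omega>) -` A \<inter> space M | A.
              A \<in> sets (Pi\<^sub>M (UNIV :: nat set) (\<lambda>_. (borel :: 'a measure)))})
          (sigma_sets (space M) {(\<lambda>\<omega> i. D i \<omega>) -` A \<inter> space M | A.
              A \<in> sets (Pi\<^sub>M (UNIV :: nat set) (\<lambda>_. (cfg_space :: 'a set measure)))}) \<and>
        (\<forall>\<omega>\<in>space M. Phi \<omega> = (\<Union>i. (\<lambda>y. X i \<omega> + y) ` D i \<omega>)))"

text \<open>Reduced Palm probability at the origin of a stationary point process, defined via the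
  Campbell--Mecke formula with reference window W = B(o,1):
  P^!_o(E) = E[ sum_{x in Phi cap W} 1(Phi - x minus {o} in E) ] / E[Phi(W)].\<close>

definition reduced_palm_prob ::
  "'w measure \<Rightarrow> ('w \<Rightarrow> 'a::euclidean_space set) \<Rightarrow> 'a set set \<Rightarrow> real" where
  "reduced_palm_prob M Phi E =
     enn2real ((\<integral>\<^sup>+\<omega>. (\<Sum>x\<in>Phi \<omega> \<inter> ball 0 1.
                    indicator E ((\<lambda>z. z - x) ` (Phi \<omega> - {x})) :: ennreal) \<partial>M)
             / (\<integral>\<^sup>+\<omega>. ennreal (real (card (Phi \<omega> \<inter> ball 0 1))) \<partial>M))"

definition nn_dist_cdf :: "'w measure \<Rightarrow> ('w \<Rightarrow> 'a::euclidean_space set) \<Rightarrow> real \<Rightarrow> real" where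
  "nn_dist_cdf M Phi r = 1 - reduced_palm_prob M Phi {\<phi>. \<phi> \<inter> cball 0 r = {}}"

definition contact_cdf :: "'w measure \<Rightarrow> ('w \<Rightarrow> 'a::euclidean_space set) \<Rightarrow> real \<Rightarrow> real" where
  "contact_cdf M Phi r = measure M {\<omega> \<in> space M. \<exists>z\<in>Phi \<omega>. norm z \<le> r}"

definition lens_vol :: "'a::euclidean_space itself \<Rightarrow> real \<Rightarrow> real \<Rightarrow> real \<Rightarrow> real" where
  "lens_vol _ r rd x =
     measure lebesgue (cball (0::'a) r \<inter> cball (x *\<^sub>R (SOME b. b \<in> (Basis :: 'a set))) rd)"

end

(* Condition on the parents. A point X_i + y of a cluster has no other point of Phi within distance r iff
   its own cluster has none and all the other clusters have none. By the Mecke formula for the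
   daughters the first event has conditional probability exp (- hit r y), where hit r y is the daughter
   intensity of the ball of radius r about y; the other clusters contribute exp of minus the sum of
   hit r (X_i + y - X_j) over j ~= i. The Mecke formula for the parents, together with
   their stationarity, turns the expectation of the latter into the void probability of Phi, which
   factors out. What remains is the mean of exp (- hit r y) over the ball of radius rd; since hit is
   radial, polar coordinates give the stated integral.

   The Mecke formula itself only has to be checked on products of a bounded set B with a void
   event of C, since these form an intersection-stable generator; there it reduces
   to the independence of the counts in B - C, B Int C and C - B. *)

theory Submission
  imports Defs
begin

section \<open>Locally finite configurations\<close>

text \<open>All processes live on one sample space, so conditioning is carried out by decoupling:
  independence allows the second of two parts of the randomness to be evaluated at a separate sample
  point \<open>\<omega>'\<close> without changing the expectation. This happens twice, for parents
  against daughters and then for one cluster against the rest. The Palm sum runs over the set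
  \<open>Phi \<omega>\<close>, while independence is known only for enumerated clusters. The sum may
  be split by cluster only if different clusters almost surely share no point, which needs an
  argument of its own. Conversely, the sum over parent indices must be turned back into a sum over
  the unordered parent set, because the Mecke formula and stationarity speak about that set. The
  sigma-algebra on configurations knows nothing but counts in bounded sets. Therefore every
  functional is written as a sum over the points of a configuration or as an avoidance predicate,
  the two forms for which measurability is proved in general.\<close>

lemma space_cfg_space [simp]: "space cfg_space = lf_configs"
  unfolding cfg_space_def by (rule space_measure_of) auto

lemma sets_cfg_space:
  "sets (cfg_space :: 'a::euclidean_space set measure) = sigma_sets lf_configs
     {{\<phi> \<in> lf_configs. card (\<phi> \<inter> B) = k} | B k. B \<in> sets borel \<and> bounded B}"
  unfolding cfg_space_def by (rule sets_measure_of) auto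

lemma lf_configs_finite_Int: "\<phi> \<in> lf_configs \<Longrightarrow> bounded B \<Longrightarrow> finite (\<phi> \<inter> B)"
  by (auto simp: lf_configs_def)

lemma lf_configs_mono: "\<phi> \<in> lf_configs \<Longrightarrow> \<psi> \<subseteq> \<phi> \<Longrightarrow> \<psi> \<in> lf_configs"
  unfolding lf_configs_def mem_Collect_eq
  by (meson Int_mono finite_subset order_refl)

lemma UN_ball_nat: "(\<Union>k::nat. ball (0::'a::real_normed_vector) (real k)) = UNIV"
  using reals_Archimedean2 by (auto simp: dist_norm)

text \<open>Countability is what later permits the exchange of an expectation with a sum over the
  points of a frozen cluster.\<close>

lemma lf_configs_countable:
  assumes "\<phi> \<in> lf_configs" shows "countable \<phi>"
proof -
  have "\<phi> = (\<Union>k::nat. \<phi> \<inter> ball 0 (real k))" using UN_ball_nat by blast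
  moreover have "countable (\<Union>k::nat. \<phi> \<inter> ball 0 (real k))"
    using lf_configs_finite_Int[OF assms, of "ball 0 (real k)" for k]
    by (intro countable_UN) (auto intro: countable_finite)
  ultimately show ?thesis by simp
qed

lemma measurable_card_cfg_space [measurable]:
  assumes "B \<in> sets borel" "bounded B"
  shows "(\<lambda>\<phi>. card (\<phi> \<inter> B)) \<in> measurable cfg_space (count_space UNIV)"
proof (subst measurable_count_space_eq2_countable)
  have "(\<lambda>\<phi>. card (\<phi> \<inter> B)) -` {k} \<inter> space cfg_space \<in> sets cfg_space" for k
    unfolding sets_cfg_space using assms by (intro sigma_sets.Basic) (auto simp: vimage_def)
  then show "(\<lambda>\<phi>. card (\<phi> \<inter> B)) \<in> space cfg_space \<rightarrow> UNIV \<and>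
    (\<forall>a\<in>UNIV. (\<lambda>\<phi>. card (\<phi> \<inter> B)) -` {a} \<inter> space cfg_space \<in> sets cfg_space)"
    by auto
qed

section \<open>Void events as a generator of the configuration sigma-algebra\<close>

definition void_event :: "'a::euclidean_space set \<Rightarrow> 'a set set" where
  "void_event C = {\<phi> \<in> lf_configs. \<phi> \<inter> C = {}}"

definition void_events :: "'a::euclidean_space set set set" where
  "void_events = {void_event C | C. C \<in> sets borel \<and> bounded C}"

lemma void_event_sets: "C \<in> sets borel \<Longrightarrow> bounded C \<Longrightarrow> void_event C \<in> sets cfg_space"
proof -
  assume C: "C \<in> sets borel" "bounded C"
  have "void_event C = {\<phi> \<in> space cfg_space. card (\<phi> \<inter> C) = 0}"
    using C by (auto simp: void_event_def lf_configs_finite_Int)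
  also have "\<dots> \<in> sets cfg_space" using C by measurable
  finally show ?thesis .
qed

text \<open>Avoiding two bounded sets means avoiding their union, which is again bounded. The
  counting events in the definition of \<open>cfg_space\<close> have no such closure
  property.\<close>

lemma Int_stable_void_events: "Int_stable void_events"
proof (rule Int_stableI)
  fix a b :: "'a set set" assume "a \<in> void_events" "b \<in> void_events"
  then obtain C C' where C: "a = void_event C" "b = void_event C'"
    "C \<in> sets borel" "C' \<in> sets borel" "bounded C" "bounded C'" by (auto simp: void_events_def)
  have "a \<inter> b = void_event (C \<union> C')" unfolding C(1,2) by (auto simp: void_event_def)
  moreover have "void_event (C \<union> C') \<in> void_events"
    using C(3-6) unfolding void_events_def by (intro CollectI exI[of _ "C \<union> C'"]) simp
  ultimately show "a \<inter> b \<in> void_events" by (simp only:)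
qed

text \<open>Finitely many points have a positive minimal distance \<open>d\<close>, and base sets
  chosen inside the balls of radius \<open>d/2\<close> about them cannot meet. This supplies the
  witnesses that a configuration has many points in a given set.\<close>

lemma finite_separated_basis:
  fixes S :: "'a::metric_space set"
  assumes B: "topological_basis B" and S: "finite S"
  obtains U where "\<And>x. x \<in> S \<Longrightarrow> U x \<in> B \<and> x \<in> U x" "disjoint_family_on U S"
proof -
  obtain d where d: "d > 0" "\<And>x y. x \<in> S \<Longrightarrow> y \<in> S \<Longrightarrow> x \<noteq> y \<Longrightarrow> d \<le> dist x y"
  proof -
    have "\<forall>x. \<exists>e>0. \<forall>y\<in>S. y \<noteq> x \<longrightarrow> e \<le> dist x y"
      using finite_set_avoid[OF S] by blast
    then obtain e where "\<forall>x. e x > 0 \<and> (\<forall>y\<in>S. y \<noteq> x \<longrightarrow> e x \<le> dist x y)"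
      unfolding choice_iff by blast
    then have e: "e x > 0" "y \<in> S \<Longrightarrow> y \<noteq> x \<Longrightarrow> e x \<le> dist x y" for x y by auto
    \<comment> \<open>The inserted 1 keeps the minimum meaningful when \<open>S\<close> is
      empty.\<close>
    show ?thesis
    proof (rule that[of "Min (insert 1 (e ` S))"])
      show "0 < Min (insert 1 (e ` S))" using S e(1) by (subst Min_gr_iff) auto
      show "Min (insert 1 (e ` S)) \<le> dist x y" if "x \<in> S" "y \<in> S" "x \<noteq> y" for x y
        using S that e(2)[of y x] by (intro order_trans[OF Min_le[of _ "e x"]]) auto
    qed
  qed
  have "\<exists>U\<in>B. x \<in> U \<and> U \<subseteq> ball x (d/2)" for x
    using topological_basisE[OF B, of "ball x (d/2)" x] d(1) by (auto simp: Bex_def)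
  then obtain U where "\<forall>x. U x \<in> B \<and> x \<in> U x \<and> U x \<subseteq> ball x (d/2)"
    unfolding Bex_def choice_iff[symmetric] by metis
  then have U: "U x \<in> B" "x \<in> U x" "U x \<subseteq> ball x (d/2)" for x by auto
  have "U x \<inter> U y = {}" if "x \<in> S" "y \<in> S" "x \<noteq> y" for x y
  proof -
    have "ball x (d/2) \<inter> ball y (d/2) = {}"
      using d(2)[OF that] by (intro disjoint_ballI) auto
    then show ?thesis using U(3)[of x] U(3)[of y] by blast
  qed
  then show ?thesis using U by (intro that[of U]) (auto simp: disjoint_family_on_def)
qed

text \<open>A configuration has at least k points in B iff it hits k pairwise disjoint members of a
  countable base inside B; so the counts are determined by void events.\<close>

lemma sets_cfg_space_void:
  "sets (cfg_space :: 'a::euclidean_space set measure) = sigma_sets lf_configs void_events"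
proof (rule antisym)
  show "sigma_sets lf_configs void_events \<subseteq> sets (cfg_space :: 'a set measure)"
    using void_event_sets sets.sigma_sets_subset[of void_events "cfg_space :: 'a set measure"]
    by (auto simp: void_events_def)
next
  interpret V: sigma_algebra lf_configs "sigma_sets lf_configs (void_events :: 'a set set set)"
    by (rule sigma_algebra_sigma_sets) (auto simp: void_events_def void_event_def)
  obtain \<B> :: "'a set set" where \<B>: "countable \<B>" "topological_basis \<B>"
    using ex_countable_basis by blast
  have hit: "{\<phi> \<in> lf_configs. \<phi> \<inter> C \<noteq> {}} \<in> sigma_sets lf_configs void_events"
    if "C \<in> sets borel" "bounded C" for C :: "'a set"
  proof -
    have "{\<phi> \<in> lf_configs. \<phi> \<inter> C \<noteq> {}} = lf_configs - void_event C" by (auto simp: void_event_def)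
    also have "\<dots> \<in> sigma_sets lf_configs void_events"
      using that by (intro sigma_sets.Compl sigma_sets.Basic) (auto simp: void_events_def)
    finally show ?thesis .
  qed
  have ge: "{\<phi> \<in> lf_configs. k \<le> card (\<phi> \<inter> B)} \<in> sigma_sets lf_configs void_events"
    if B: "B \<in> sets borel" "bounded B" for B :: "'a set" and k
  proof -
    \<comment> \<open>Only finite subfamilies of the countable base occur, so \<open>\<F>\<close> is
      countable and the union over it below stays inside the sigma-algebra.\<close>
    define \<F> where "\<F> = {F. finite F \<and> F \<subseteq> \<B> \<and> disjoint F \<and> card F = k}"
    have "countable \<F>"
      using countable_Collect_finite_subset[OF \<B>(1)]
      by (rule countable_subset[rotated]) (auto simp: \<F>_def)
    have eq: "{\<phi> \<in> lf_configs. k \<le> card (\<phi> \<inter> B)} =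
        (\<Union>F\<in>\<F>. {\<phi> \<in> lf_configs. \<forall>U\<in>F. \<phi> \<inter> (B \<inter> U) \<noteq> {}})"
    proof safe
      fix \<phi> :: "'a set" assume \<phi>: "\<phi> \<in> lf_configs" "k \<le> card (\<phi> \<inter> B)"
      then obtain S where S: "S \<subseteq> \<phi> \<inter> B" "card S = k" "finite S"
        using obtain_subset_with_card_n by metis
      obtain U where U: "\<And>x. x \<in> S \<Longrightarrow> U x \<in> \<B> \<and> x \<in> U x" "disjoint_family_on U S"
        using finite_separated_basis[OF \<B>(2) S(3)] by metis
      have "inj_on U S"
      proof (rule inj_onI, rule ccontr)
        fix x y assume xy: "x \<in> S" "y \<in> S" "U x = U y" "x \<noteq> y"
        then have "U x \<inter> U y = {}" using U(2) unfolding disjoint_family_on_def by blast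
        then show False using U(1)[OF xy(1)] xy(3) by simp
      qed
      then have "U ` S \<in> \<F>"
        using U S by (auto simp: \<F>_def card_image disjoint_family_on_disjoint_image)
      moreover have "\<forall>V\<in>U ` S. \<phi> \<inter> (B \<inter> V) \<noteq> {}" using U S by blast
      ultimately show "\<phi> \<in> (\<Union>F\<in>\<F>. {\<phi> \<in> lf_configs. \<forall>U\<in>F. \<phi> \<inter> (B \<inter> U) \<noteq> {}})"
        using \<phi>(1) by blast
    next
      fix \<phi> :: "'a set" and F assume \<phi>: "\<phi> \<in> lf_configs" and F: "F \<in> \<F>"
        and "\<forall>U\<in>F. \<phi> \<inter> (B \<inter> U) \<noteq> {}"
      then have "\<forall>U\<in>F. \<exists>y. y \<in> \<phi> \<inter> B \<inter> U" by blast
      then obtain f where "\<forall>U\<in>F. f U \<in> \<phi> \<inter> B \<inter> U" unfolding bchoice_iff by blast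
      then have f: "f U \<in> \<phi> \<inter> B \<inter> U" if "U \<in> F" for U using that by blast
      have "inj_on f F"
      proof (rule inj_onI, rule ccontr)
        fix U V assume UV: "U \<in> F" "V \<in> F" "f U = f V" "U \<noteq> V"
        then have "U \<inter> V = {}" using F by (auto simp: \<F>_def disjoint_def)
        then show False using f[OF UV(1)] f[OF UV(2)] UV(3) by auto
      qed
      moreover have "f ` F \<subseteq> \<phi> \<inter> B" using f by blast
      ultimately have "card F \<le> card (\<phi> \<inter> B)"
        using card_mono[OF lf_configs_finite_Int[OF \<phi> B(2)], of "f ` F"] by (simp add: card_image)
      then show "k \<le> card (\<phi> \<inter> B)" using F by (simp add: \<F>_def)
    qed
    have "{\<phi> \<in> lf_configs. \<forall>U\<in>F. \<phi> \<inter> (B \<inter> U) \<noteq> {}} \<in> sigma_sets lf_configs void_events"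
      if F: "F \<in> \<F>" for F
    proof (rule V.sets_Collect_finite_All)
      fix U assume "U \<in> F"
      then have "open U" using F topological_basis_open[OF \<B>(2)] by (auto simp: \<F>_def)
      then show "{\<phi> \<in> lf_configs. \<phi> \<inter> (B \<inter> U) \<noteq> {}} \<in> sigma_sets lf_configs void_events"
        using B by (intro hit) (auto intro: bounded_subset)
    qed (use F in \<open>auto simp: \<F>_def\<close>)
    then show ?thesis
      unfolding eq by (intro V.countable_UN' \<open>countable \<F>\<close>) auto
  qed
  show "sets (cfg_space :: 'a set measure) \<subseteq> sigma_sets lf_configs void_events"
    unfolding sets_cfg_space
  proof (rule V.sigma_sets_subset, safe)
    fix B :: "'a set" and k assume B: "B \<in> sets borel" "bounded B"
    have "{\<phi> \<in> lf_configs. card (\<phi> \<inter> B) = k} =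
      {\<phi> \<in> lf_configs. k \<le> card (\<phi> \<inter> B)} - {\<phi> \<in> lf_configs. Suc k \<le> card (\<phi> \<inter> B)}" by auto
    also have "\<dots> \<in> sigma_sets lf_configs void_events" by (intro V.Diff ge B)
    finally show "{\<phi> \<in> lf_configs. card (\<phi> \<inter> B) = k} \<in> sigma_sets lf_configs void_events" .
  qed
qed

section \<open>Measurability of sums and avoidance predicates over a random configuration\<close>

lemma nn_integral_count_space_finite_indicator:
  fixes f :: "'a \<Rightarrow> ennreal"
  assumes "finite (\<phi> \<inter> B)"
  shows "(\<integral>\<^sup>+x. f x * indicator B x \<partial>count_space \<phi>) = (\<Sum>x\<in>\<phi> \<inter> B. f x)"
proof -
  have "(\<integral>\<^sup>+x. f x * indicator B x \<partial>count_space \<phi>) = (\<integral>\<^sup>+x. f x \<partial>count_space (\<phi> \<inter> B))"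
    by (subst (1 2) nn_integral_count_space_indicator)
       (auto intro!: nn_integral_cong split: split_indicator)
  also have "\<dots> = (\<Sum>x\<in>\<phi> \<inter> B. f x)" using assms by (rule nn_integral_count_space_finite)
  finally show ?thesis .
qed

text \<open>Normalising the counting measure on a ball turns it into a sub-probability kernel, for which
  the library provides joint measurability.\<close>

lemma measurable_nn_integral_cfg:
  fixes f :: "'a::euclidean_space \<Rightarrow> 'p \<Rightarrow> ennreal"
  assumes f: "(\<lambda>(y, p). f y p) \<in> borel_measurable (borel \<Otimes>\<^sub>M N)"
    and g: "g \<in> measurable N cfg_space"
  shows "(\<lambda>p. \<integral>\<^sup>+y. f y p \<partial>count_space (g p)) \<in> borel_measurable N"
proof -
  note f[measurable] g[measurable]
  have lf: "g p \<in> lf_configs" if "p \<in> space N" for p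
    using measurable_space[OF g that] by simp
  \<comment> \<open>The law of a uniformly chosen point among those in the ball of radius
    \<open>k\<close>, pushed to \<open>borel\<close> so that all these laws live on one measurable
    space. It is the null measure when the ball contains no point, hence only a
    sub-probability.\<close>
  define U where "U k \<phi> = distr (uniform_count_measure (\<phi> \<inter> ball 0 (real k))) borel (\<lambda>x. x)"
    for k :: nat and \<phi> :: "'a set"
  have U_int: "of_nat (card (\<phi> \<inter> ball 0 (real k))) * (\<integral>\<^sup>+y. h y \<partial>U k \<phi>)
      = (\<Sum>y\<in>\<phi> \<inter> ball 0 (real k). h y)"
    if "\<phi> \<in> lf_configs" "h \<in> borel_measurable borel" for k \<phi> and h :: "'a \<Rightarrow> ennreal"
  proof -
    let ?A = "\<phi> \<inter> ball 0 (real k)"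
    have fin: "finite ?A" using that by (intro lf_configs_finite_Int) auto
    have "(\<integral>\<^sup>+y. h y \<partial>U k \<phi>) = (\<integral>\<^sup>+y. h y \<partial>uniform_count_measure ?A)"
      unfolding U_def by (rule nn_integral_distr) (auto simp: that)
    also have "\<dots> = (\<Sum>y\<in>?A. ennreal (1 / real (card ?A)) * h y)"
      unfolding uniform_count_measure_def
      using fin by (simp add: nn_integral_point_measure_finite)
    also have "\<dots> = ennreal (1 / real (card ?A)) * (\<Sum>y\<in>?A. h y)" by (simp add: sum_distrib_left)
    finally have "of_nat (card ?A) * (\<integral>\<^sup>+y. h y \<partial>U k \<phi>) =
        (ennreal (real (card ?A)) * ennreal (1 / real (card ?A))) * (\<Sum>y\<in>?A. h y)"
      by (simp add: ennreal_of_nat_eq_real_of_nat mult.assoc)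
    \<comment> \<open>The factor counting the points cancels the normalisation; for empty
      \<open>?A\<close> both sides are 0.\<close>
    also have "\<dots> = (\<Sum>y\<in>?A. h y)"
      using fin by (cases "?A = {}") (simp_all flip: ennreal_mult)
    finally show ?thesis .
  qed
  have U[measurable]: "U k \<in> measurable cfg_space (subprob_algebra borel)" for k
  proof (rule measurable_subprob_algebra)
    fix \<phi> :: "'a set" assume "\<phi> \<in> space cfg_space"
    then have fin: "finite (\<phi> \<inter> ball 0 (real k))" by (intro lf_configs_finite_Int) auto
    show "subprob_space (U k \<phi>)"
    proof
      have "emeasure (U k \<phi>) (space (U k \<phi>)) =
          emeasure (uniform_count_measure (\<phi> \<inter> ball 0 (real k))) (\<phi> \<inter> ball 0 (real k))"
        unfolding U_def by (subst emeasure_distr) (auto simp: space_uniform_count_measure)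
      also have "\<dots> \<le> 1"
        using fin by (subst emeasure_uniform_count_measure) (auto simp: divide_le_eq_1)
      finally show "emeasure (U k \<phi>) (space (U k \<phi>)) \<le> 1" .
    qed (simp add: U_def)
    show "sets (U k \<phi>) = sets borel" by (simp add: U_def)
  next
    fix A :: "'a set" assume A: "A \<in> sets borel"
    have "emeasure (U k \<phi>) A =
        of_nat (card (\<phi> \<inter> (ball 0 (real k) \<inter> A))) / of_nat (card (\<phi> \<inter> ball 0 (real k)))"
      if \<phi>: "\<phi> \<in> space cfg_space" for \<phi>
    proof -
      have fin: "finite (\<phi> \<inter> ball 0 (real k))" using \<phi> by (intro lf_configs_finite_Int) auto
      have "emeasure (U k \<phi>) A = emeasure (uniform_count_measure (\<phi> \<inter> ball 0 (real k))) (A \<inter> (\<phi> \<inter> ball 0 (real k)))"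
        unfolding U_def using A by (subst emeasure_distr) (auto simp: space_uniform_count_measure)
      also have "\<dots> = ennreal (real (card (\<phi> \<inter> (ball 0 (real k) \<inter> A))) / real (card (\<phi> \<inter> ball 0 (real k))))"
        using fin by (subst emeasure_uniform_count_measure) (auto simp: Int_ac)
      also have "\<dots> = of_nat (card (\<phi> \<inter> (ball 0 (real k) \<inter> A))) / of_nat (card (\<phi> \<inter> ball 0 (real k)))"
      \<comment> \<open>Without points both quotients are \<open>0 / 0\<close>, which has the value
        0 in the reals and in \<open>ennreal\<close> alike.\<close>
      proof (cases "\<phi> \<inter> ball 0 (real k) = {}")
        case True then show ?thesis by (simp add: Int_assoc[symmetric])
      next
        case False
        then have "0 < card (\<phi> \<inter> ball 0 (real k))" using fin by (simp add: card_gt_0_iff)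
        then show ?thesis by (simp add: divide_ennreal ennreal_of_nat_eq_real_of_nat)
      qed
      finally show ?thesis .
    qed
    moreover have "(\<lambda>\<phi>. of_nat (card (\<phi> \<inter> (ball 0 (real k) \<inter> A))) /
        of_nat (card (\<phi> \<inter> ball 0 (real k))) :: ennreal) \<in> borel_measurable cfg_space"
    proof -
      have [measurable]: "(\<lambda>\<phi>. card (\<phi> \<inter> (ball 0 (real k) \<inter> A))) \<in> measurable cfg_space (count_space UNIV)"
        "(\<lambda>\<phi>. card (\<phi> \<inter> ball 0 (real k) :: 'a set)) \<in> measurable cfg_space (count_space UNIV)"
        using A by (intro measurable_card_cfg_space; auto)+
      show ?thesis by measurable
    qed
    ultimately show "(\<lambda>\<phi>. emeasure (U k \<phi>) A) \<in> borel_measurable cfg_space"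
      by (subst measurable_cong) auto
  qed
  have [measurable]: "(\<lambda>p. card (g p \<inter> ball 0 (real k))) \<in> measurable N (count_space UNIV)" for k
    by (rule measurable_compose[OF g measurable_card_cfg_space]) auto
  have [measurable]: "(\<lambda>p. \<integral>\<^sup>+y. f y p \<partial>U k (g p)) \<in> borel_measurable N" for k
    by (rule nn_integral_measurable_subprob_algebra2[where N=borel]) measurable
  \<comment> \<open>A configuration may be infinite; it is recovered as the increasing limit of its
    finite parts in growing balls, and suprema of sequences preserve measurability.\<close>
  have "(\<integral>\<^sup>+y. f y p \<partial>count_space (g p)) =
      (SUP k. of_nat (card (g p \<inter> ball 0 (real k))) * (\<integral>\<^sup>+y. f y p \<partial>U k (g p)))"
    if p: "p \<in> space N" for p
  proof -
    have fp: "(\<lambda>y. f y p) \<in> borel_measurable borel" using p by measurable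
    have "(\<integral>\<^sup>+y. f y p \<partial>count_space (g p))
        = (\<integral>\<^sup>+y. (SUP k::nat. f y p * indicator (ball 0 (real k)) y) \<partial>count_space (g p))"
    proof (rule nn_integral_cong)
      fix y :: 'a
      obtain k :: nat where "y \<in> ball 0 (real k)" using UN_ball_nat by blast
      then show "f y p = (SUP k::nat. f y p * indicator (ball 0 (real k)) y)"
        by (intro antisym SUP_upper2[of k] SUP_least) (auto split: split_indicator)
    qed
    also have "\<dots> = (SUP k::nat. \<integral>\<^sup>+y. f y p * indicator (ball 0 (real k)) y \<partial>count_space (g p))"
      by (rule nn_integral_monotone_convergence_SUP)
         (auto simp: incseq_def le_fun_def split: split_indicator)
    also have "\<dots> = (SUP k. of_nat (card (g p \<inter> ball 0 (real k))) * (\<integral>\<^sup>+y. f y p \<partial>U k (g p)))"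
      using lf[OF p]
      by (simp add: U_int[OF lf[OF p] fp] nn_integral_count_space_finite_indicator lf_configs_finite_Int)
    finally show ?thesis .
  qed
  then show ?thesis
    by (subst measurable_cong) (auto intro!: borel_measurable_SUP)
qed

lemma nn_integral_count_space_eq_0_iff:
  "(\<integral>\<^sup>+y. f y \<partial>count_space A) = 0 \<longleftrightarrow> (\<forall>y\<in>A. f y = 0)"
  by (subst nn_integral_0_iff_AE) (auto simp: AE_count_space)

text \<open>A configuration avoids the region given by \<open>Q\<close> exactly when the number of
  its points there is 0, and that number is an integral covered by
  \<open>measurable_nn_integral_cfg\<close>. This handles avoidance events whose region varies with
  the parameter \<open>p\<close>.\<close>

lemma measurable_void_pred:
  fixes g :: "'p \<Rightarrow> 'a::euclidean_space set"
  assumes Q: "Measurable.pred (borel \<Otimes>\<^sub>M N) (\<lambda>(y, p). Q y p)"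
    and g: "g \<in> measurable N cfg_space"
  shows "Measurable.pred N (\<lambda>p. \<forall>y\<in>g p. \<not> Q y p)"
proof -
  have [measurable]: "{x \<in> space (borel \<Otimes>\<^sub>M N). case x of (y, p) \<Rightarrow> Q y p} \<in> sets (borel \<Otimes>\<^sub>M N)"
    using Q by (simp add: pred_def)
  have m: "(\<lambda>(y, p). indicator {x \<in> space (borel \<Otimes>\<^sub>M N). case x of (y, p) \<Rightarrow> Q y p} (y, p) :: ennreal)
      \<in> borel_measurable (borel \<Otimes>\<^sub>M N)"
    by (simp add: case_prod_beta)
  have [measurable]: "(\<lambda>p. \<integral>\<^sup>+y. indicator {x \<in> space (borel \<Otimes>\<^sub>M N). case x of (y, p) \<Rightarrow> Q y p} (y, p)
      \<partial>count_space (g p)) \<in> borel_measurable N"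
    by (rule measurable_nn_integral_cfg[OF m g])
  have eq: "(\<forall>y\<in>g p. \<not> Q y p) \<longleftrightarrow>
      (\<integral>\<^sup>+y. indicator {x \<in> space (borel \<Otimes>\<^sub>M N). case x of (y, p) \<Rightarrow> Q y p} (y, p) \<partial>count_space (g p)) = (0::ennreal)"
    if "p \<in> space N" for p
    using that by (auto simp: nn_integral_count_space_eq_0_iff space_pair_measure indicator_def)
  show ?thesis by (subst measurable_cong[OF eq]) measurable
qed

section \<open>Poisson processes and the Mecke formula\<close>

text \<open>The library notion \<open>indep_var\<close> forces X and Y to take values in the same type, so independence is phrased here as
  factorisation over rectangles.\<close>

lemma (in prob_space) nn_integral_decouple:
  fixes f :: "'b \<times> 'c \<Rightarrow> ennreal"
  assumes X[measurable]: "X \<in> measurable M S" and Y[measurable]: "Y \<in> measurable M T"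
    and ind: "\<And>A B. A \<in> sets S \<Longrightarrow> B \<in> sets T \<Longrightarrow>
      prob ((X -` A \<inter> space M) \<inter> (Y -` B \<inter> space M)) = prob (X -` A \<inter> space M) * prob (Y -` B \<inter> space M)"
    and f[measurable]: "f \<in> borel_measurable (S \<Otimes>\<^sub>M T)"
  shows "(\<integral>\<^sup>+\<omega>. f (X \<omega>, Y \<omega>) \<partial>M) = (\<integral>\<^sup>+\<omega>. \<integral>\<^sup>+\<omega>'. f (X \<omega>, Y \<omega>') \<partial>M \<partial>M)"
proof -
  interpret S: prob_space "distr M S X" by (rule prob_space_distr) fact
  interpret T: prob_space "distr M T Y" by (rule prob_space_distr) fact
  have f'[measurable]: "f \<in> borel_measurable (distr M S X \<Otimes>\<^sub>M distr M T Y)"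
    using f by (simp cong: measurable_cong_sets)
  have eq: "distr M S X \<Otimes>\<^sub>M distr M T Y = distr M (S \<Otimes>\<^sub>M T) (\<lambda>\<omega>. (X \<omega>, Y \<omega>))"
  proof (rule pair_measure_eqI)
    show "sigma_finite_measure (distr M S X)" "sigma_finite_measure (distr M T Y)" by unfold_locales
    show "sets (distr M S X \<Otimes>\<^sub>M distr M T Y) = sets (distr M (S \<Otimes>\<^sub>M T) (\<lambda>\<omega>. (X \<omega>, Y \<omega>)))"
      by (simp cong: sets_pair_measure_cong)
    fix A B assume "A \<in> sets (distr M S X)" "B \<in> sets (distr M T Y)"
    then have AB[measurable]: "A \<in> sets S" "B \<in> sets T" by auto
    have "emeasure (distr M (S \<Otimes>\<^sub>M T) (\<lambda>\<omega>. (X \<omega>, Y \<omega>))) (A \<times> B) =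
        emeasure M ((X -` A \<inter> space M) \<inter> (Y -` B \<inter> space M))"
      by (subst emeasure_distr) (auto intro!: arg_cong[where f="emeasure M"])
    also have "\<dots> = emeasure (distr M S X) A * emeasure (distr M T Y) B"
      using ind[OF AB] by (simp add: emeasure_distr emeasure_eq_measure ennreal_mult)
    finally show "emeasure (distr M S X) A * emeasure (distr M T Y) B =
        emeasure (distr M (S \<Otimes>\<^sub>M T) (\<lambda>\<omega>. (X \<omega>, Y \<omega>))) (A \<times> B)" ..
  qed
  have "(\<integral>\<^sup>+\<omega>. f (X \<omega>, Y \<omega>) \<partial>M) = (\<integral>\<^sup>+p. f p \<partial>distr M (S \<Otimes>\<^sub>M T) (\<lambda>\<omega>. (X \<omega>, Y \<omega>)))"
    by (subst nn_integral_distr) auto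
  also have "\<dots> = (\<integral>\<^sup>+p. f p \<partial>(distr M S X \<Otimes>\<^sub>M distr M T Y))"
    by (simp add: eq)
  also have "\<dots> = (\<integral>\<^sup>+x. \<integral>\<^sup>+y. f (x, y) \<partial>distr M T Y \<partial>distr M S X)"
    by (rule T.nn_integral_fst[symmetric]) fact
  also have "\<dots> = (\<integral>\<^sup>+x. \<integral>\<^sup>+\<omega>'. f (x, Y \<omega>') \<partial>M \<partial>distr M S X)"
  proof (intro nn_integral_cong)
    fix x assume "x \<in> space (distr M S X)"
    then have "x \<in> space S" by simp
    then show "(\<integral>\<^sup>+y. f (x, y) \<partial>distr M T Y) = (\<integral>\<^sup>+\<omega>'. f (x, Y \<omega>') \<partial>M)"
      by (intro nn_integral_distr) measurable
  qed
  also have "\<dots> = (\<integral>\<^sup>+\<omega>. \<integral>\<^sup>+\<omega>'. f (X \<omega>, Y \<omega>') \<partial>M \<partial>M)"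
    by (rule nn_integral_distr) measurable
  finally show ?thesis .
qed

lemma (in prob_space) indep_var_decouple:
  assumes "indep_var S X T Y" "f \<in> borel_measurable (S \<Otimes>\<^sub>M T)"
  shows "(\<integral>\<^sup>+\<omega>. f (X \<omega>, Y \<omega>) \<partial>M) = (\<integral>\<^sup>+\<omega>. \<integral>\<^sup>+\<omega>'. f (X \<omega>, Y \<omega>') \<partial>M \<partial>M)"
proof (rule nn_integral_decouple)
  fix A B assume AB: "A \<in> sets S" "B \<in> sets T"
  have "(X -` A \<inter> space M) \<inter> (Y -` B \<inter> space M) = (\<lambda>x. (X x, Y x)) -` (A \<times> B) \<inter> space M" by auto
  then show "prob ((X -` A \<inter> space M) \<inter> (Y -` B \<inter> space M)) = prob (X -` A \<inter> space M) * prob (Y -` B \<inter> space M)"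
    using indep_varD[OF assms(1) AB] by simp
qed (use assms in \<open>auto dest: indep_var_rv1 indep_var_rv2\<close>)

text \<open>The void events generate by \<open>sets_cfg_space_void\<close>, so no count of points
  has to be examined.\<close>

lemma measurable_cfg_spaceI:
  fixes g :: "'w \<Rightarrow> 'a::euclidean_space set"
  assumes "\<And>\<omega>. \<omega> \<in> space M \<Longrightarrow> g \<omega> \<in> lf_configs"
    and "\<And>C. C \<in> sets borel \<Longrightarrow> bounded C \<Longrightarrow> {\<omega> \<in> space M. g \<omega> \<inter> C = {}} \<in> sets M"
  shows "g \<in> measurable M cfg_space"
proof (rule measurable_sigma_sets[OF sets_cfg_space_void])
  show "(void_events :: 'a set set set) \<subseteq> Pow lf_configs"
    by (auto simp: void_events_def void_event_def)
  show "g \<in> space M \<rightarrow> lf_configs" using assms(1) by auto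
  fix V :: "'a set set" assume "V \<in> void_events"
  then obtain C where C: "V = void_event C" "C \<in> sets borel" "bounded C"
    unfolding void_events_def by blast
  have "g -` V \<inter> space M = {\<omega> \<in> space M. g \<omega> \<inter> C = {}}"
    using assms(1) C(1) by (auto simp: void_event_def)
  then show "g -` V \<inter> space M \<in> sets M" using assms(2)[OF C(2,3)] by simp
qed

text \<open>Instead of shrinking the configuration one shrinks the tested region:
  \<open>\<phi> - {y}\<close> avoids \<open>C\<close> iff \<open>\<phi>\<close> has no point in
  \<open>C\<close> different from \<open>y\<close>. The condition is jointly measurable, as
  \<open>measurable_void_pred\<close> requires. The Mecke formula needs this map.\<close>

lemma measurable_cfg_remove_point:
  "(\<lambda>(y, \<phi>). \<phi> - {y}) \<in> measurable (borel \<Otimes>\<^sub>M cfg_space) (cfg_space :: 'a::euclidean_space set measure)"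
proof (rule measurable_cfg_spaceI)
  fix p :: "'a \<times> 'a set" assume "p \<in> space (borel \<Otimes>\<^sub>M cfg_space)"
  then show "(case p of (y, \<phi>) \<Rightarrow> \<phi> - {y}) \<in> lf_configs"
    by (auto simp: space_pair_measure intro: lf_configs_mono)
next
  fix C :: "'a set" assume [measurable]: "C \<in> sets borel"
  have "Measurable.pred (borel \<Otimes>\<^sub>M cfg_space) (\<lambda>p::'a \<times> 'a set. \<forall>z\<in>snd p. \<not> (z \<in> C \<and> z \<noteq> fst p))"
    by (rule measurable_void_pred) measurable
  then have "{p \<in> space (borel \<Otimes>\<^sub>M cfg_space). \<forall>z\<in>snd p. \<not> (z \<in> C \<and> z \<noteq> fst p)} \<in> sets (borel \<Otimes>\<^sub>M (cfg_space :: 'a set measure))"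
    by (simp add: pred_def)
  also have "{p \<in> space (borel \<Otimes>\<^sub>M cfg_space). \<forall>z\<in>snd p. \<not> (z \<in> C \<and> z \<noteq> fst p)} =
     {p \<in> space (borel \<Otimes>\<^sub>M cfg_space). (case p of (y, \<phi>) \<Rightarrow> \<phi> - {y}) \<inter> C = {}}"
    by auto
  finally show "{p \<in> space (borel \<Otimes>\<^sub>M cfg_space). (case p of (y, \<phi>) \<Rightarrow> \<phi> - {y}) \<inter> C = {}}
    \<in> sets (borel \<Otimes>\<^sub>M (cfg_space :: 'a set measure))" .
qed

text \<open>The mean of the Poisson law: the term at 0 vanishes, and the shift by one cancels a
  factor of the factorial, leaving \<open>l * exp (- l)\<close> times the exponential
  series.\<close>

lemma poisson_mean_sums:
  "(\<lambda>k. real k * (exp (- l) * l ^ k / fact k)) sums (l::real)"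
proof -
  have "(\<lambda>k. (l * exp (- l)) * (l ^ k /\<^sub>R fact k)) sums (l * exp (- l) * exp l)"
    by (intro sums_mult exp_converges)
  moreover have "real (Suc k) * (exp (- l) * l ^ Suc k / fact (Suc k)) = l * exp (- l) * (l ^ k /\<^sub>R fact k)" for k
    by (simp add: divide_simps del: of_nat_Suc)
  moreover have "l * exp (- l) * exp l = l" by (simp add: exp_minus)
  ultimately have "(\<lambda>k. real (Suc k) * (exp (- l) * l ^ Suc k / fact (Suc k))) sums l" by simp
  then show ?thesis by (subst (asm) sums_Suc_iff) simp
qed

text \<open>Boxes are bounded and generate. Bounded sets are wanted because
  \<open>poisson_pp\<close> makes statements about no others.\<close>

lemma sets_borel_bounded:
  "sets (borel :: 'a::euclidean_space measure) = sigma_sets UNIV {B. B \<in> sets borel \<and> bounded B}"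
proof (rule antisym)
  show "sigma_sets UNIV {B. B \<in> sets borel \<and> bounded B} \<subseteq> sets (borel :: 'a measure)"
    using sets.sigma_sets_subset[of "{B. B \<in> sets borel \<and> bounded B}" "borel :: 'a measure"] by auto
  have "sets (borel :: 'a measure) = sigma_sets UNIV (range (\<lambda>(a, b). box a b))"
    by (subst borel_eq_box) (rule sets_measure_of, simp)
  also have "\<dots> \<subseteq> sigma_sets UNIV {B. B \<in> sets borel \<and> bounded B}"
    by (intro sigma_sets_mono') auto
  finally show "sets (borel :: 'a measure) \<subseteq> sigma_sets UNIV {B. B \<in> sets borel \<and> bounded B}" .
qed

text \<open>\<open>poisson_pp\<close> knows its intensity only as a set function; the Mecke formula
  has to integrate against it, hence the measure \<open>L\<close>. Finiteness on bounded sets keeps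
  \<open>measure L\<close> from falling back to its default 0 for infinite mass.\<close>

locale poisson_config = prob_space M for M :: "'w measure" +
  fixes N :: "'w \<Rightarrow> 'a::euclidean_space set" and L :: "'a measure"
  assumes poisson: "poisson_pp M N (measure L)"
    and sets_L [measurable_cong]: "sets L = sets borel"
    and finite_L: "B \<in> sets borel \<Longrightarrow> bounded B \<Longrightarrow> emeasure L B < \<infinity>"
begin

lemma measurable_N [measurable]: "N \<in> measurable M cfg_space"
  using poisson by (simp add: poisson_pp_def)

lemma N_lf: "\<omega> \<in> space M \<Longrightarrow> N \<omega> \<in> lf_configs"
  using measurable_space[OF measurable_N] by simp

lemma finite_N: "\<omega> \<in> space M \<Longrightarrow> bounded B \<Longrightarrow> finite (N \<omega> \<inter> B)"
  by (intro lf_configs_finite_Int N_lf)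

lemma emeasure_L: "B \<in> sets borel \<Longrightarrow> bounded B \<Longrightarrow> emeasure L B = ennreal (measure L B)"
  using finite_L by (intro emeasure_eq_ennreal_measure) (auto simp: less_top)

lemma measurable_count [measurable]:
  "B \<in> sets borel \<Longrightarrow> bounded B \<Longrightarrow> (\<lambda>\<omega>. card (N \<omega> \<inter> B)) \<in> measurable M (count_space UNIV)"
  by (rule measurable_compose[OF measurable_N measurable_card_cfg_space])

lemma prob_count:
  "B \<in> sets borel \<Longrightarrow> bounded B \<Longrightarrow>
    prob {\<omega> \<in> space M. card (N \<omega> \<inter> B) = k} = exp (- measure L B) * measure L B ^ k / fact k"
  using poisson by (simp add: poisson_pp_def)

lemma void_prob:
  assumes "B \<in> sets borel" "bounded B"
  shows "prob {\<omega> \<in> space M. N \<omega> \<inter> B = {}} = exp (- measure L B)"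
proof -
  have "{\<omega> \<in> space M. N \<omega> \<inter> B = {}} = {\<omega> \<in> space M. card (N \<omega> \<inter> B) = 0}"
    using assms by (auto simp: finite_N)
  then show ?thesis using prob_count[OF assms, of 0] by simp
qed

lemma mean_count:
  assumes B: "B \<in> sets borel" "bounded B"
  shows "(\<integral>\<^sup>+\<omega>. of_nat (card (N \<omega> \<inter> B)) \<partial>M) = emeasure L B"
proof -
  note measurable_count[OF B, measurable]
  have "(\<integral>\<^sup>+\<omega>. of_nat (card (N \<omega> \<inter> B)) \<partial>M) =
      (\<integral>\<^sup>+\<omega>. (\<Sum>k. of_nat k * indicator {\<omega> \<in> space M. card (N \<omega> \<inter> B) = k} \<omega>) \<partial>M)"
  proof (rule nn_integral_cong)
    fix \<omega> assume \<omega>: "\<omega> \<in> space M"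
    have "(\<Sum>k. of_nat k * indicator {\<omega> \<in> space M. card (N \<omega> \<inter> B) = k} \<omega> :: ennreal) =
       (\<Sum>k\<in>{card (N \<omega> \<inter> B)}. of_nat k * indicator {\<omega> \<in> space M. card (N \<omega> \<inter> B) = k} \<omega>)"
      by (rule suminf_finite) (auto simp: indicator_def)
    then show "of_nat (card (N \<omega> \<inter> B)) =
       (\<Sum>k. of_nat k * indicator {\<omega> \<in> space M. card (N \<omega> \<inter> B) = k} \<omega> :: ennreal)"
      using \<omega> by simp
  qed
  also have "\<dots> = (\<Sum>k. \<integral>\<^sup>+\<omega>. of_nat k * indicator {\<omega> \<in> space M. card (N \<omega> \<inter> B) = k} \<omega> \<partial>M)"
    by (rule nn_integral_suminf) measurable
  also have "\<dots> = (\<Sum>k. ennreal (real k * (exp (- measure L B) * measure L B ^ k / fact k)))"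
    by (intro suminf_cong, subst nn_integral_cmult_indicator)
       (simp_all add: emeasure_eq_measure prob_count[OF B] ennreal_of_nat_eq_real_of_nat flip: ennreal_mult)
  also have "\<dots> = ennreal (measure L B)"
    by (rule suminf_ennreal_eq[OF _ poisson_mean_sums]) simp
  finally show ?thesis using emeasure_L[OF B] by simp
qed

lemma indep_counts:
  assumes A: "A \<in> sets borel" "bounded A" and B: "B \<in> sets borel" "bounded B" and AB: "A \<inter> B = {}"
  shows "(\<integral>\<^sup>+\<omega>. f (card (N \<omega> \<inter> A)) * g (card (N \<omega> \<inter> B)) \<partial>M) =
    (\<integral>\<^sup>+\<omega>. f (card (N \<omega> \<inter> A)) \<partial>M) * (\<integral>\<^sup>+\<omega>. g (card (N \<omega> \<inter> B)) \<partial>M)"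
    (is "?lhs = ?rhs")
proof -
  note measurable_count[OF A, measurable] measurable_count[OF B, measurable]
  \<comment> \<open>Independence in \<open>poisson_pp\<close> is stated for families indexed by
    naturals, so the pair is coded by the indices 0 and 1.\<close>
  let ?Bs = "\<lambda>i::nat. if i = 0 then A else B"
  have "indep_vars (\<lambda>_. count_space UNIV) (\<lambda>i \<omega>. card (N \<omega> \<inter> ?Bs i)) {0, 1}"
  proof -
    have "\<forall>(I :: nat set) (Bs :: nat \<Rightarrow> 'a set).
        finite I \<and> disjoint_family_on Bs I \<and> (\<forall>i\<in>I. Bs i \<in> sets borel \<and> bounded (Bs i)) \<longrightarrow>
        indep_vars (\<lambda>_. count_space UNIV) (\<lambda>i \<omega>. card (N \<omega> \<inter> Bs i)) I"
      using poisson unfolding poisson_pp_def by blast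
    moreover have "disjoint_family_on ?Bs {0, 1}" using AB by (auto simp: disjoint_family_on_def)
    ultimately show ?thesis using A B by (auto split del: if_split split: if_splits)
  qed
  from indep_var_restrict[OF this, of "{0}" "{1}"]
  have "indep_var (count_space UNIV) ((\<lambda>h. h 0) \<circ> (\<lambda>\<omega>. \<lambda>i\<in>{0}. card (N \<omega> \<inter> ?Bs i)))
      (count_space UNIV) ((\<lambda>h. h 1) \<circ> (\<lambda>\<omega>. \<lambda>i\<in>{1}. card (N \<omega> \<inter> ?Bs i)))"
    by (rule indep_var_compose) (auto intro!: measurable_component_singleton)
  then have "indep_var (count_space UNIV) (\<lambda>\<omega>. card (N \<omega> \<inter> A)) (count_space UNIV) (\<lambda>\<omega>. card (N \<omega> \<inter> B))"
    by (simp add: comp_def)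
  from indep_var_decouple[OF this, of "\<lambda>(a, b). f a * g b"]
  have "?lhs = (\<integral>\<^sup>+\<omega>. \<integral>\<^sup>+\<omega>'. f (card (N \<omega> \<inter> A)) * g (card (N \<omega>' \<inter> B)) \<partial>M \<partial>M)"
    by (simp add: pair_measure_countable)
  also have "\<dots> = ?rhs" by (simp add: nn_integral_cmult nn_integral_multc)
  finally show ?thesis .
qed

text \<open>A point of \<open>B - C\<close> is counted iff \<open>C\<close> contains no point at
  all; a point of \<open>B \<inter> C\<close> is counted iff it is the only point in
  \<open>C\<close>. By independence over disjoint sets the two contributions are
  \<open>L (B - C) * exp (- L C)\<close> and \<open>L (B \<inter> C) * exp (- L (B \<inter> C)) *
  exp (- L (C - B))\<close>, where \<open>L\<close> stands for its value on the set. The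
  exponentials merge into \<open>exp (- L C)\<close> and the prefactors into
  \<open>L B\<close>.\<close>

lemma mecke_rectangle:
  assumes B: "B \<in> sets borel" "bounded B" and C: "C \<in> sets borel" "bounded C"
  shows "(\<integral>\<^sup>+\<omega>. \<integral>\<^sup>+y. indicator (B \<times> void_event C) (y, N \<omega> - {y}) \<partial>count_space (N \<omega>) \<partial>M)
    = emeasure L B * ennreal (exp (- measure L C))"
proof -
  have BC: "B - C \<in> sets borel" "bounded (B - C)" "B \<inter> C \<in> sets borel" "bounded (B \<inter> C)"
    "C - B \<in> sets borel" "bounded (C - B)"
    using assms by (auto intro: bounded_subset)
  let ?z = "\<lambda>k::nat. indicator {0} k :: ennreal" and ?o = "\<lambda>k::nat. indicator {1} k :: ennreal"
  have split: "(\<integral>\<^sup>+y. indicator (B \<times> void_event C) (y, N \<omega> - {y}) \<partial>count_space (N \<omega>)) =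
      of_nat (card (N \<omega> \<inter> (B - C))) * ?z (card (N \<omega> \<inter> C)) +
      ?o (card (N \<omega> \<inter> (B \<inter> C))) * ?z (card (N \<omega> \<inter> (C - B)))" if \<omega>: "\<omega> \<in> space M" for \<omega>
  proof -
    let ?\<phi> = "N \<omega>"
    have fin: "finite (?\<phi> \<inter> A)" if "bounded A" for A using finite_N[OF \<omega> that] .
    have lf: "?\<phi> - {y} \<in> lf_configs" for y using N_lf[OF \<omega>] by (rule lf_configs_mono) auto
    have "(\<integral>\<^sup>+y. indicator (B \<times> void_event C) (y, ?\<phi> - {y}) \<partial>count_space ?\<phi>) =
       (\<integral>\<^sup>+y. indicator (void_event C) (?\<phi> - {y}) * indicator B y \<partial>count_space ?\<phi>)"
      by (intro nn_integral_cong) (auto split: split_indicator)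
    also have "\<dots> = (\<Sum>y\<in>?\<phi> \<inter> B. indicator (void_event C) (?\<phi> - {y}))"
      by (rule nn_integral_count_space_finite_indicator) (intro fin B)
    also have "\<dots> = (\<Sum>y\<in>(?\<phi> \<inter> (B - C)) \<union> (?\<phi> \<inter> (B \<inter> C)). indicator (void_event C) (?\<phi> - {y}))"
      by (intro sum.cong) auto
    also have "\<dots> = (\<Sum>y\<in>?\<phi> \<inter> (B - C). indicator (void_event C) (?\<phi> - {y})) +
        (\<Sum>y\<in>?\<phi> \<inter> (B \<inter> C). indicator (void_event C) (?\<phi> - {y}))"
      using BC by (intro sum.union_disjoint fin) auto
    also have "(\<Sum>y\<in>?\<phi> \<inter> (B - C). indicator (void_event C) (?\<phi> - {y}) :: ennreal) =
        (\<Sum>y\<in>?\<phi> \<inter> (B - C). ?z (card (?\<phi> \<inter> C)))"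
      using fin[OF C(2)] lf by (intro sum.cong) (auto simp: void_event_def indicator_def)
    also have "\<dots> = of_nat (card (?\<phi> \<inter> (B - C))) * ?z (card (?\<phi> \<inter> C))" by simp
    also have "(\<Sum>y\<in>?\<phi> \<inter> (B \<inter> C). indicator (void_event C) (?\<phi> - {y}) :: ennreal) =
        ?o (card (?\<phi> \<inter> (B \<inter> C))) * ?z (card (?\<phi> \<inter> (C - B)))"
    \<comment> \<open>Removing \<open>y\<close> clears \<open>C\<close> only if \<open>y\<close> is
      the sole point there, so the sum has one term 1 or only terms 0.\<close>
    proof (cases "\<exists>y. ?\<phi> \<inter> (B \<inter> C) = {y} \<and> ?\<phi> \<inter> (C - B) = {}")
      case True
      then obtain y where y: "?\<phi> \<inter> (B \<inter> C) = {y}" "?\<phi> \<inter> (C - B) = {}" by blast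
      have "(?\<phi> - {y}) \<inter> C = {}" using y by blast
      then show ?thesis unfolding y using lf[of y] by (simp add: void_event_def)
    next
      case False
      have "(?\<phi> - {y}) \<inter> C \<noteq> {}" if "y \<in> ?\<phi> \<inter> (B \<inter> C)" for y
      proof
        assume "(?\<phi> - {y}) \<inter> C = {}"
        then have "?\<phi> \<inter> (B \<inter> C) = {y} \<and> ?\<phi> \<inter> (C - B) = {}" using that by blast
        then show False using False by blast
      qed
      then have "(\<Sum>y\<in>?\<phi> \<inter> (B \<inter> C). indicator (void_event C) (?\<phi> - {y}) :: ennreal) = 0"
        by (intro sum.neutral) (auto simp: void_event_def)
      moreover have "\<not> (card (?\<phi> \<inter> (B \<inter> C)) = 1 \<and> card (?\<phi> \<inter> (C - B)) = 0)"
        using False fin[OF BC(6)] by (auto simp: card_1_singleton_iff)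
      ultimately show ?thesis by (auto simp: indicator_def)
    qed
    finally show ?thesis .
  qed
  have ind: "(\<integral>\<^sup>+\<omega>. indicator {k} (card (N \<omega> \<inter> A)) \<partial>M) =
      ennreal (exp (- measure L A) * measure L A ^ k / fact k)"
    if A: "A \<in> sets borel" "bounded A" for A and k :: nat
  proof -
    note measurable_count[OF A, measurable]
    have "(\<integral>\<^sup>+\<omega>. indicator {k} (card (N \<omega> \<inter> A)) \<partial>M) =
        (\<integral>\<^sup>+\<omega>. indicator {\<omega> \<in> space M. card (N \<omega> \<inter> A) = k} \<omega> \<partial>M)"
      by (intro nn_integral_cong) (auto simp: indicator_def)
    also have "\<dots> = emeasure M {\<omega> \<in> space M. card (N \<omega> \<inter> A) = k}" by (rule nn_integral_indicator) measurable
    finally show ?thesis by (simp add: emeasure_eq_measure prob_count[OF A])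
  qed
  have add_L: "measure L (A \<union> A') = measure L A + measure L A'"
    if "A \<in> sets borel" "bounded A" "A' \<in> sets borel" "bounded A'" "A \<inter> A' = {}" for A A'
    using that finite_L[of A] finite_L[of A'] sets_L by (intro measure_Union) auto
  have C_split: "measure L C = measure L (B \<inter> C) + measure L (C - B)"
  proof -
    have "C = (B \<inter> C) \<union> (C - B)" "(B \<inter> C) \<inter> (C - B) = {}" by auto
    with add_L[OF BC(3-6)] show ?thesis by simp
  qed
  have B_split: "measure L B = measure L (B - C) + measure L (B \<inter> C)"
  proof -
    have "B = (B - C) \<union> (B \<inter> C)" "(B - C) \<inter> (B \<inter> C) = {}" by auto
    with add_L[OF BC(1-4)] show ?thesis by simp
  qed
  have mc: "(\<lambda>\<omega>. h (card (N \<omega> \<inter> A))) \<in> borel_measurable M"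
    if "A \<in> sets borel" "bounded A" for A and h :: "nat \<Rightarrow> ennreal"
    by (rule measurable_compose[OF measurable_count[OF that]]) simp
  have "(\<integral>\<^sup>+\<omega>. \<integral>\<^sup>+y. indicator (B \<times> void_event C) (y, N \<omega> - {y}) \<partial>count_space (N \<omega>) \<partial>M) =
     (\<integral>\<^sup>+\<omega>. of_nat (card (N \<omega> \<inter> (B - C))) * ?z (card (N \<omega> \<inter> C)) +
      ?o (card (N \<omega> \<inter> (B \<inter> C))) * ?z (card (N \<omega> \<inter> (C - B))) \<partial>M)"
    by (intro nn_integral_cong split)
  also have "\<dots> = (\<integral>\<^sup>+\<omega>. of_nat (card (N \<omega> \<inter> (B - C))) * ?z (card (N \<omega> \<inter> C)) \<partial>M) +
      (\<integral>\<^sup>+\<omega>. ?o (card (N \<omega> \<inter> (B \<inter> C))) * ?z (card (N \<omega> \<inter> (C - B))) \<partial>M)"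
    using BC C by (intro nn_integral_add borel_measurable_times_ennreal mc)
  also have "\<dots> = emeasure L (B - C) * ennreal (exp (- measure L C)) +
      ennreal (exp (- measure L (B \<inter> C)) * measure L (B \<inter> C)) * ennreal (exp (- measure L (C - B)))"
    using BC C by (subst (1 2) indep_counts) (auto simp: ind mean_count)
  also have "\<dots> = ennreal (measure L B * exp (- measure L C))"
  proof -
    have "exp (- measure L C) = exp (- measure L (B \<inter> C)) * exp (- measure L (C - B))"
      unfolding C_split by (simp flip: exp_add)
    then show ?thesis
      unfolding emeasure_L[OF BC(1,2)] B_split
      by (simp add: algebra_simps flip: ennreal_mult ennreal_plus)
  qed
  also have "\<dots> = emeasure L B * ennreal (exp (- measure L C))"
    by (simp add: emeasure_L[OF B] ennreal_mult)
  finally show ?thesis .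
qed

text \<open>Both sides are measures in \<open>A\<close> that agree on rectangles by
  \<open>mecke_rectangle\<close> and are finite along an exhausting sequence of rectangles, hence
  they coincide.\<close>

lemma mecke_set:
  assumes A: "A \<in> sets (borel \<Otimes>\<^sub>M cfg_space)"
  shows "(\<integral>\<^sup>+\<omega>. \<integral>\<^sup>+y. indicator A (y, N \<omega> - {y}) \<partial>count_space (N \<omega>) \<partial>M) =
    emeasure (L \<Otimes>\<^sub>M distr M cfg_space N) A"
proof -
  let ?P = "borel \<Otimes>\<^sub>M cfg_space :: ('a \<times> 'a set) measure"
  let ?I = "\<lambda>A. \<integral>\<^sup>+\<omega>. \<integral>\<^sup>+y. indicator A (y, N \<omega> - {y}) \<partial>count_space (N \<omega>) \<partial>M"
  \<comment> \<open>The reduced Campbell measure of \<open>N\<close>; that it is a measure is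
    checked in \<open>emC\<close>.\<close>
  define C where "C = measure_of (space ?P) (sets ?P) ?I"
  interpret D: prob_space "distr M cfg_space N" by (rule prob_space_distr) measurable
  have sp: "space ?P = UNIV \<times> lf_configs" by (simp add: space_pair_measure)
  note measurable_cfg_remove_point[measurable]
  have meas: "(\<lambda>\<omega>. \<integral>\<^sup>+y. indicator A (y, N \<omega> - {y}) \<partial>count_space (N \<omega>)) \<in> borel_measurable M"
    if [measurable]: "A \<in> sets ?P" for A
  proof (rule measurable_nn_integral_cfg)
    have "(\<lambda>p. (fst p, (\<lambda>(y, \<phi>). \<phi> - {y}) (fst p, N (snd p)))) \<in> measurable (borel \<Otimes>\<^sub>M M) ?P"
      by measurable
    then have [measurable]: "(\<lambda>p. (fst p, N (snd p) - {fst p})) \<in> measurable (borel \<Otimes>\<^sub>M M) ?P"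
      by simp
    show "(\<lambda>(y, \<omega>). indicator A (y, N \<omega> - {y}) :: ennreal) \<in> borel_measurable (borel \<Otimes>\<^sub>M M)"
      by (simp add: case_prod_beta)
  qed measurable
  have emC: "emeasure C A = ?I A" if "A \<in> sets ?P" for A
    unfolding C_def
  proof (rule emeasure_measure_of_sigma)
    show "sigma_algebra (space ?P) (sets ?P)" ..
    show "positive (sets ?P) ?I" by (simp add: positive_def)
    show "countably_additive (sets ?P) ?I"
    proof (rule countably_additiveI)
      fix F :: "nat \<Rightarrow> ('a \<times> 'a set) set"
      assume F: "range F \<subseteq> sets ?P" "disjoint_family F"
      have "(\<Sum>i. ?I (F i)) = (\<integral>\<^sup>+\<omega>. (\<Sum>i. \<integral>\<^sup>+y. indicator (F i) (y, N \<omega> - {y}) \<partial>count_space (N \<omega>)) \<partial>M)"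
        using F meas by (intro nn_integral_suminf[symmetric]) auto
      also have "\<dots> = (\<integral>\<^sup>+\<omega>. \<integral>\<^sup>+y. (\<Sum>i. indicator (F i) (y, N \<omega> - {y})) \<partial>count_space (N \<omega>) \<partial>M)"
        by (intro nn_integral_cong nn_integral_suminf[symmetric]) auto
      also have "\<dots> = ?I (\<Union>i. F i)"
        using F(2) by (intro nn_integral_cong suminf_indicator)
      finally show "(\<Sum>i. ?I (F i)) = ?I (\<Union>i. F i)" .
    qed
  qed (use that in auto)
  let ?E = "{B \<times> V | B V. B \<in> {B::'a set. B \<in> sets borel \<and> bounded B} \<and> V \<in> (void_events :: 'a set set set)}"
  have ball: "(\<Union>k::nat. ball (0::'a) (real k)) = UNIV" by (rule UN_ball_nat)
  have E0: "{} \<in> sets (borel :: 'a measure)" "bounded ({} :: 'a set)" by auto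
  have ve: "void_event {} = (lf_configs :: 'a set set)" by (simp add: void_event_def)
  have vee: "void_event {} \<in> (void_events :: 'a set set set)"
    unfolding void_events_def by (rule CollectI, rule exI[of _ "{}"]) simp
  have sets_P: "sets ?P = sigma_sets (UNIV \<times> lf_configs) ?E"
  proof -
    have "sets ?P = sets (sigma (space borel \<times> space cfg_space) ?E)"
    proof (rule sets_pair_eq)
      show "sets borel = sigma_sets (space borel) {B::'a set. B \<in> sets borel \<and> bounded B}"
        using sets_borel_bounded by simp
      show "void_events \<subseteq> Pow (space cfg_space :: 'a set set)"
        by (auto simp: void_events_def void_event_def)
      show "sets cfg_space = sigma_sets (space cfg_space) (void_events :: 'a set set set)"
        using sets_cfg_space_void by simp
      show "countable (range (\<lambda>k::nat. ball (0::'a) (real k)))" by simp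
      show "\<Union>(range (\<lambda>k::nat. ball (0::'a) (real k))) = space borel" using ball by simp
      show "{lf_configs} \<subseteq> (void_events :: 'a set set set)"
        using vee ve by simp
    qed auto
    also have "\<dots> = sigma_sets (space borel \<times> space cfg_space) ?E"
      by (rule sets_measure_of) (auto simp: void_events_def void_event_def)
    finally show ?thesis by simp
  qed
  have "C = L \<Otimes>\<^sub>M distr M cfg_space N"
  proof (rule measure_eqI_generator_eq)
    show "Int_stable ?E"
    proof (rule Int_stableI)
      fix a b assume "a \<in> ?E" "b \<in> ?E"
      then obtain B V B' V' where *: "a = B \<times> V" "b = B' \<times> V'" "B \<in> sets borel" "bounded B"
        "B' \<in> sets borel" "bounded B'" "V \<in> void_events" "V' \<in> void_events" by blast
      have "V \<inter> V' \<in> void_events" using Int_stable_void_events *(7,8) by (rule Int_stableD)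
      moreover have "B \<inter> B' \<in> sets borel" "bounded (B \<inter> B')" using * by auto
      moreover have "a \<inter> b = (B \<inter> B') \<times> (V \<inter> V')" using *(1,2) by auto
      ultimately show "a \<inter> b \<in> ?E" by blast
    qed
    show "?E \<subseteq> Pow (UNIV \<times> lf_configs)" by (auto simp: void_events_def void_event_def)
    show "sets C = sigma_sets (UNIV \<times> lf_configs) ?E"
      unfolding C_def sets_P[symmetric] by (subst sets_measure_of[OF sets.space_closed]) (rule sets.sigma_sets_eq)
    show "sets (L \<Otimes>\<^sub>M distr M cfg_space N) = sigma_sets (UNIV \<times> lf_configs) ?E"
      using sets_pair_measure_cong[OF sets_L sets_distr[of M cfg_space N]] sets_P by simp
    fix X assume "X \<in> ?E"
    then obtain B V where X: "X = B \<times> V" "B \<in> sets borel" "bounded B" "V \<in> void_events" by blast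
    then obtain D where D: "V = void_event D" "D \<in> sets borel" "bounded D"
      unfolding void_events_def by blast
    have V: "V \<in> sets cfg_space" using D by (simp add: void_event_sets)
    have "{\<omega> \<in> space M. N \<omega> \<inter> D = {}} = N -` V \<inter> space M"
      using N_lf D(1) by (auto simp: void_event_def)
    then have "emeasure (distr M cfg_space N) V = ennreal (exp (- measure L D))"
      using V void_prob[OF D(2,3)] by (simp add: emeasure_distr emeasure_eq_measure)
    moreover have "emeasure C X = emeasure L B * ennreal (exp (- measure L D))"
      using X V unfolding D(1) X(1) by (subst emC) (auto intro: mecke_rectangle D)
    ultimately show "emeasure C X = emeasure (L \<Otimes>\<^sub>M distr M cfg_space N) X"
      using X V sets_L by (simp add: D.emeasure_pair_measure_Times)
  next
    \<comment> \<open>The full configuration space is written as \<open>void_event {}\<close> so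
      that the exhausting rectangles belong to the generator.\<close>
    let ?F = "\<lambda>k::nat. ball (0::'a) (real k) \<times> void_event ({} :: 'a set)"
    show "range ?F \<subseteq> ?E"
    proof (rule image_subsetI)
      show "?F k \<in> ?E" for k using vee by (intro CollectI exI[of _ "ball 0 (real k)"] exI[of _ "void_event {}"]) simp
    qed
    show "(\<Union>k. ?F k) = UNIV \<times> lf_configs" unfolding ve ball[symmetric] by blast
    show "emeasure C (?F k) \<noteq> \<infinity>" for k
    proof -
      have "emeasure C (?F k) = emeasure L (ball 0 (real k)) * ennreal (exp (- measure L {}))"
        using void_event_sets[OF E0] mecke_rectangle[of "ball 0 (real k)", OF _ _ E0]
        by (subst emC) simp_all
      then show ?thesis using finite_L[of "ball 0 (real k)"] by (simp add: ennreal_mult_eq_top_iff)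
    qed
  qed
  then show ?thesis using emC[OF A] by simp
qed

theorem mecke:
  assumes f: "f \<in> borel_measurable (borel \<Otimes>\<^sub>M cfg_space)"
  shows "(\<integral>\<^sup>+\<omega>. \<integral>\<^sup>+y. f (y, N \<omega> - {y}) \<partial>count_space (N \<omega>) \<partial>M) = (\<integral>\<^sup>+y. \<integral>\<^sup>+\<omega>. f (y, N \<omega>) \<partial>M \<partial>L)"
proof -
  let ?P = "borel \<Otimes>\<^sub>M cfg_space :: ('a \<times> 'a set) measure"
  interpret D: prob_space "distr M cfg_space N" by (rule prob_space_distr) measurable
  note measurable_cfg_remove_point[measurable]
  have meas: "(\<lambda>\<omega>. \<integral>\<^sup>+y. g (y, N \<omega> - {y}) \<partial>count_space (N \<omega>)) \<in> borel_measurable M"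
    if [measurable]: "g \<in> borel_measurable ?P" for g :: "_ \<Rightarrow> ennreal"
  proof (rule measurable_nn_integral_cfg)
    have "(\<lambda>p. (fst p, (\<lambda>(y, \<phi>). \<phi> - {y}) (fst p, N (snd p)))) \<in> measurable (borel \<Otimes>\<^sub>M M) ?P"
      by measurable
    then have [measurable]: "(\<lambda>p. (fst p, N (snd p) - {fst p})) \<in> measurable (borel \<Otimes>\<^sub>M M) ?P"
      by simp
    show "(\<lambda>(y, \<omega>). g (y, N \<omega> - {y}) :: ennreal) \<in> borel_measurable (borel \<Otimes>\<^sub>M M)"
      by (simp add: case_prod_beta)
  qed measurable
  have sets_eq: "sets (L \<Otimes>\<^sub>M distr M cfg_space N) = sets ?P"
    using sets_L by (simp cong: sets_pair_measure_cong)
  have mk: "g \<in> borel_measurable (L \<Otimes>\<^sub>M distr M cfg_space N)" if "g \<in> borel_measurable ?P" for g :: "_ \<Rightarrow> ennreal"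
    using that measurable_cong_sets[OF sets_eq refl] by blast
  from f have "(\<integral>\<^sup>+\<omega>. \<integral>\<^sup>+y. f (y, N \<omega> - {y}) \<partial>count_space (N \<omega>) \<partial>M) =
      (\<integral>\<^sup>+p. f p \<partial>(L \<Otimes>\<^sub>M distr M cfg_space N))"
  proof (induction f rule: borel_measurable_induct)
    case (cong f g)
    have "(\<integral>\<^sup>+\<omega>. \<integral>\<^sup>+y. f (y, N \<omega> - {y}) \<partial>count_space (N \<omega>) \<partial>M) =
        (\<integral>\<^sup>+\<omega>. \<integral>\<^sup>+y. g (y, N \<omega> - {y}) \<partial>count_space (N \<omega>) \<partial>M)"
      by (intro nn_integral_cong cong)
         (auto simp: space_pair_measure intro: lf_configs_mono[OF N_lf])
    moreover have "(\<integral>\<^sup>+p. f p \<partial>(L \<Otimes>\<^sub>M distr M cfg_space N)) = (\<integral>\<^sup>+p. g p \<partial>(L \<Otimes>\<^sub>M distr M cfg_space N))"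
      using sets_eq_imp_space_eq[OF sets_eq] cong by (intro nn_integral_cong) auto
    ultimately show ?case using cong by simp
  next
    case (set A)
    then show ?case using mecke_set[of A] sets_eq by simp
  next
    case (mult u c)
    then show ?case by (simp add: nn_integral_cmult meas mk)
  next
    case (add u v)
    then show ?case by (simp add: nn_integral_add meas mk)
  next
    case (seq U)
    have inc: "incseq U" and mU: "U i \<in> borel_measurable ?P"
      and IH: "(\<integral>\<^sup>+\<omega>. \<integral>\<^sup>+y. U i (y, N \<omega> - {y}) \<partial>count_space (N \<omega>) \<partial>M) =
        (\<integral>\<^sup>+p. U i p \<partial>(L \<Otimes>\<^sub>M distr M cfg_space N))" for i by fact+
    have "(\<integral>\<^sup>+\<omega>. \<integral>\<^sup>+y. (SUP i. U i) (y, N \<omega> - {y}) \<partial>count_space (N \<omega>) \<partial>M) =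
        (\<integral>\<^sup>+\<omega>. (SUP i. \<integral>\<^sup>+y. U i (y, N \<omega> - {y}) \<partial>count_space (N \<omega>)) \<partial>M)"
      using inc by (subst nn_integral_monotone_convergence_SUP[symmetric])
        (auto simp: incseq_def le_fun_def image_comp)
    also have "\<dots> = (SUP i. \<integral>\<^sup>+\<omega>. \<integral>\<^sup>+y. U i (y, N \<omega> - {y}) \<partial>count_space (N \<omega>) \<partial>M)"
      using inc meas[OF mU] by (intro nn_integral_monotone_convergence_SUP)
        (auto simp: incseq_def le_fun_def intro!: nn_integral_mono)
    also have "\<dots> = (SUP i. \<integral>\<^sup>+p. U i p \<partial>(L \<Otimes>\<^sub>M distr M cfg_space N))" using IH by simp
    also have "\<dots> = (\<integral>\<^sup>+p. (SUP i. U i) p \<partial>(L \<Otimes>\<^sub>M distr M cfg_space N))"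
      unfolding SUP_apply using inc mk[OF mU]
      by (rule nn_integral_monotone_convergence_SUP[symmetric])
    finally show ?case .
  qed
  also have "\<dots> = (\<integral>\<^sup>+y. \<integral>\<^sup>+\<phi>. f (y, \<phi>) \<partial>distr M cfg_space N \<partial>L)"
    by (rule D.nn_integral_fst[symmetric]) (rule mk[OF f])
  also have "\<dots> = (\<integral>\<^sup>+y. \<integral>\<^sup>+\<omega>. f (y, N \<omega>) \<partial>M \<partial>L)"
  proof (intro nn_integral_cong nn_integral_distr)
    show "(\<lambda>\<phi>. f (y, \<phi>)) \<in> borel_measurable (distr M cfg_space N)" for y
      using measurable_compose[OF measurable_Pair1'[of y borel cfg_space] f] by simp
  qed measurable
  finally show ?thesis .
qed

end

text \<open>Renyi's principle that a simple point process is determined by its void probabilities: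
  void events form a generator closed under intersection. It is what makes stationarity of the
  parents accessible.\<close>

lemma distr_cfg_space_eqI:
  fixes N :: "'w \<Rightarrow> 'a::euclidean_space set"
  assumes "prob_space M" and N[measurable]: "N \<in> measurable M cfg_space" "N' \<in> measurable M cfg_space"
    and void: "\<And>C. C \<in> sets borel \<Longrightarrow> bounded C \<Longrightarrow>
      measure M {\<omega> \<in> space M. N \<omega> \<inter> C = {}} = measure M {\<omega> \<in> space M. N' \<omega> \<inter> C = {}}"
  shows "distr M cfg_space N = distr M cfg_space N'"
proof -
  interpret prob_space M by fact
  have ve: "void_event {} = (lf_configs :: 'a set set)" by (simp add: void_event_def)
  show ?thesis
  proof (rule measure_eqI_generator_eq)
    show "Int_stable (void_events :: 'a set set set)" by (rule Int_stable_void_events)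
    show "(void_events :: 'a set set set) \<subseteq> Pow lf_configs"
      by (auto simp: void_events_def void_event_def)
    show "sets (distr M cfg_space N) = sigma_sets lf_configs void_events"
      "sets (distr M cfg_space N') = sigma_sets lf_configs void_events"
      using sets_cfg_space_void by simp_all
    show "range (\<lambda>_::nat. void_event {}) \<subseteq> (void_events :: 'a set set set)"
      unfolding void_events_def by (auto intro!: exI[of _ "{}"])
    show "(\<Union>i::nat. void_event {}) = (lf_configs :: 'a set set)" by (simp add: ve)
    show "emeasure (distr M cfg_space N) (void_event {}) \<noteq> \<infinity>"
      using void_event_sets[of "{}::'a set"] by (simp add: emeasure_distr emeasure_eq_measure)
    fix V :: "'a set set" assume "V \<in> void_events"
    then obtain D where D: "V = void_event D" "D \<in> sets borel" "bounded D"
      unfolding void_events_def by blast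
    have "{\<omega> \<in> space M. X \<omega> \<inter> D = {}} = X -` V \<inter> space M" if "X \<in> measurable M cfg_space" for X
      using measurable_space[OF that] D(1) by (auto simp: void_event_def)
    from this[OF N(1)] this[OF N(2)]
    show "emeasure (distr M cfg_space N) V = emeasure (distr M cfg_space N') V"
      using void[OF D(2,3)] D void_event_sets[of D] by (simp add: emeasure_distr emeasure_eq_measure)
  qed
qed

section \<open>Isometries, lenses and polar coordinates\<close>

lemma emeasure_ball_center:
  "emeasure lborel (ball (c::'a::euclidean_space) r) = emeasure lborel (ball (c'::'a) r)"
  by (cases "r \<ge> 0") (auto simp: emeasure_ball ball_empty)

text \<open>By Vitali's theorem an open set is, up to a null set, a countable disjoint union of balls,
  and isometries preserve balls and null sets.\<close>

lemma emeasure_isometry_open_le: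
  fixes f :: "'a::euclidean_space \<Rightarrow> 'a"
  assumes inv: "\<And>x. f (f x) = x" and iso: "\<And>x y. dist (f x) (f y) = dist x y" and S: "open S"
  shows "emeasure lborel (f ` S) \<le> emeasure lborel S"
proof -
  have f_ball: "f ` ball x d = ball (f x) d" for x d
  proof (intro set_eqI iffI)
    fix z assume "z \<in> ball (f x) d"
    then have "f z \<in> ball x d" using iso[of "f x" z] inv by simp
    then show "z \<in> f ` ball x d" using inv[of z] by (metis imageI)
  qed (auto simp: iso)
  have "inj f" using inv by (metis injI)
  let ?K = "{(x, d). 0 < d \<and> ball x d \<subseteq> S}"
  have "\<exists>i. i \<in> ?K \<and> x \<in> ball (fst i) (snd i) \<and> snd i < d" if x: "x \<in> S" and d: "0 < d" for x d
  proof -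
    obtain e where e: "e > 0" "ball x e \<subseteq> S" using S x by (meson open_contains_ball)
    \<comment> \<open>Halving \<open>d\<close> makes the radius strictly smaller than
      \<open>d\<close>, as a Vitali cover demands.\<close>
    have "ball x (min e (d/2)) \<subseteq> S" using e by auto
    then show ?thesis using e d by (intro exI[of _ "(x, min e (d/2))"]) auto
  qed
  then obtain C where C: "countable C" "C \<subseteq> ?K"
    "pairwise (\<lambda>i j. disjnt (ball (fst i) (snd i)) (ball (fst j) (snd j))) C"
    "negligible (S - (\<Union>i\<in>C. ball (fst i) (snd i)))"
    by (rule Vitali_covering_theorem_balls[of S ?K fst snd])
  have sub: "ball (fst i) (snd i) \<subseteq> S" if "i \<in> C" for i using C(2) that by (cases i) auto
  have disj: "disjoint_family_on (\<lambda>i. ball (fst i) (snd i)) C"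
    using C(3) by (auto simp: disjoint_family_on_def pairwise_def disjnt_def)
  have disj': "disjoint_family_on (\<lambda>i. f ` ball (fst i) (snd i)) C"
    unfolding disjoint_family_on_def
  proof (intro ballI impI)
    fix i j assume "i \<in> C" "j \<in> C" "i \<noteq> j"
    then have "ball (fst i) (snd i) \<inter> ball (fst j) (snd j) = {}"
      using disj by (simp add: disjoint_family_on_def)
    then show "f ` ball (fst i) (snd i) \<inter> f ` ball (fst j) (snd j) = {}"
      unfolding image_Int[OF \<open>inj f\<close>, symmetric] by simp
  qed
  let ?R = "S - (\<Union>i\<in>C. ball (fst i) (snd i))"
  have neg: "negligible (f ` ?R)"
  proof (rule negligible_locally_Lipschitz_image[OF _ C(4)])
    show "\<exists>T B. open T \<and> x \<in> T \<and> (\<forall>y\<in>?R \<inter> T. norm (f y - f x) \<le> B * norm (y - x))" for x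
      using iso by (intro exI[of _ UNIV] exI[of _ 1]) (auto simp: dist_norm)
  qed simp
  have U: "(\<Union>i\<in>C. f ` ball (fst i) (snd i)) \<in> sets lborel"
    by (simp add: f_ball) (intro borel_open open_UN, simp)
  have fS: "f ` S = (\<Union>i\<in>C. f ` ball (fst i) (snd i)) \<union> f ` ?R"
  proof -
    have "S = (\<Union>i\<in>C. ball (fst i) (snd i)) \<union> ?R" using sub by blast
    then have "f ` S = f ` (\<Union>i\<in>C. ball (fst i) (snd i)) \<union> f ` ?R" by (metis image_Un)
    then show ?thesis by (simp only: image_UN)
  qed
  have "f ` S = f -` S"
  proof (intro set_eqI iffI)
    fix z assume "z \<in> f -` S"
    then have "f (f z) \<in> f ` S" by blast
    then show "z \<in> f ` S" by (simp only: inv)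
  qed (auto simp: inv)
  moreover have "continuous_on UNIV f"
    unfolding continuous_on_iff by (auto simp: iso)
  ultimately have "open (f ` S)" using S by (simp add: open_vimage)
  then have "emeasure lborel (f ` S) = emeasure lebesgue (f ` S)" by simp
  also have "\<dots> \<le> emeasure lebesgue (\<Union>i\<in>C. f ` ball (fst i) (snd i)) + emeasure lebesgue (f ` ?R)"
    unfolding fS using U neg by (intro emeasure_subadditive) (auto dest: negligible_imp_sets)
  also have "emeasure lebesgue (f ` ?R) = 0"
    using neg by (simp add: negligible_iff_null_sets null_setsD1)
  also have "emeasure lebesgue (\<Union>i\<in>C. f ` ball (fst i) (snd i)) = emeasure lborel (\<Union>i\<in>C. f ` ball (fst i) (snd i))"
    using U by simp
  also have "\<dots> = (\<integral>\<^sup>+i. emeasure lborel (f ` ball (fst i) (snd i)) \<partial>count_space C)"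
    using C(1) disj' by (intro emeasure_UN_countable) (auto simp: f_ball)
  also have "\<dots> = (\<integral>\<^sup>+i. emeasure lborel (ball (fst i) (snd i)) \<partial>count_space C)"
    unfolding f_ball by (intro nn_integral_cong emeasure_ball_center)
  also have "\<dots> = emeasure lborel (\<Union>i\<in>C. ball (fst i) (snd i))"
    using C(1) disj by (intro emeasure_UN_countable[symmetric]) auto
  also have "\<dots> \<le> emeasure lborel S"
    using S by (intro emeasure_mono UN_least sub) auto
  finally show ?thesis by simp
qed

text \<open>The missing inequality is the one-sided bound applied to the image of \<open>S\<close>,
  which the involution carries back onto \<open>S\<close>.\<close>

lemma emeasure_isometry_open:
  fixes f :: "'a::euclidean_space \<Rightarrow> 'a"
  assumes inv: "\<And>x. f (f x) = x" and iso: "\<And>x y. dist (f x) (f y) = dist x y" and S: "open S"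
  shows "emeasure lborel (f ` S) = emeasure lborel S"
proof (rule antisym)
  have "f ` S = f -` S"
  proof (intro set_eqI iffI)
    fix z assume "z \<in> f -` S"
    then have "f (f z) \<in> f ` S" by blast
    then show "z \<in> f ` S" by (simp only: inv)
  qed (auto simp: inv)
  moreover have "continuous_on UNIV f"
    unfolding continuous_on_iff by (auto simp: iso)
  ultimately have "open (f ` S)" using S by (simp add: open_vimage)
  moreover have "f ` f ` S = S" using inv by (simp add: image_image)
  ultimately show "emeasure lborel S \<le> emeasure lborel (f ` S)"
    using emeasure_isometry_open_le[OF inv iso, of "f ` S"] by simp
qed (rule emeasure_isometry_open_le[OF inv iso S])

lemma emeasure_isometry_ball_Int:
  fixes f :: "'a::euclidean_space \<Rightarrow> 'a"
  assumes inv: "\<And>x. f (f x) = x" and iso: "\<And>x y. dist (f x) (f y) = dist x y"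
  shows "emeasure lborel (ball (f a) r \<inter> ball (f b) s) = emeasure lborel (ball a r \<inter> ball b s)"
proof -
  have f_ball: "x \<in> ball (f c) d \<longleftrightarrow> f x \<in> ball c d" for x c d
    using iso[of "f c" x] inv by simp
  have "f ` (ball a r \<inter> ball b s) = ball (f a) r \<inter> ball (f b) s"
  proof (intro set_eqI iffI)
    fix z assume "z \<in> ball (f a) r \<inter> ball (f b) s"
    then have "f z \<in> ball a r \<inter> ball b s" using f_ball by blast
    then show "z \<in> f ` (ball a r \<inter> ball b s)" using inv[of z] by (metis imageI)
  qed (auto simp: iso)
  then show ?thesis using emeasure_isometry_open[OF inv iso, of "ball a r \<inter> ball b s"]
    by (simp add: open_Int)
qed

text \<open>The reflection in the hyperplane orthogonal to \<open>y - y'\<close> is an isometric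
  involution that fixes 0 and, the norms being equal, carries \<open>y\<close> to \<open>y'\<close>.
  Reflections are the reason why isometries that are their own inverse suffice above.\<close>

lemma emeasure_ball_Int_radial:
  fixes y y' :: "'a::euclidean_space"
  assumes "norm y = norm y'"
  shows "emeasure lborel (ball y r \<inter> ball 0 s) = emeasure lborel (ball y' r \<inter> ball 0 s)"
proof (cases "y = y'")
  case False
  define u where "u = y - y'"
  have u: "u \<bullet> u \<noteq> 0" using False by (simp add: u_def)
  define f where "f x = x - (2 * (x \<bullet> u) / (u \<bullet> u)) *\<^sub>R u" for x
  have lin: "f (x - z) = f x - f z" for x z
    by (simp add: f_def inner_diff_left right_diff_distrib diff_divide_distrib scaleR_left_diff_distrib algebra_simps)
  have inv: "f (f x) = x" for x
  proof -
    have "f x \<bullet> u = - (x \<bullet> u)" using u by (simp add: f_def inner_diff_left)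
    then have "f (f x) = f x + (2 * (x \<bullet> u) / (u \<bullet> u)) *\<^sub>R u" by (simp add: f_def[of "f x"])
    then show ?thesis by (simp add: f_def)
  qed
  have "f x \<bullet> f x = x \<bullet> x" for x
  proof -
    define c where "c = 2 * (x \<bullet> u) / (u \<bullet> u)"
    have c: "c * (u \<bullet> u) = 2 * (x \<bullet> u)" using u by (simp add: c_def)
    have "f x \<bullet> f x = x \<bullet> x - 2 * c * (x \<bullet> u) + c * (c * (u \<bullet> u))"
      unfolding f_def c_def[symmetric]
      by (simp add: inner_diff_left inner_diff_right inner_commute algebra_simps)
    then show ?thesis unfolding c by simp
  qed
  then have nrm: "norm (f x) = norm x" for x by (simp add: norm_eq_sqrt_inner)
  have iso: "dist (f x) (f z) = dist x z" for x z
    using nrm[of "x - z"] by (simp add: dist_norm lin)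
  have "y \<bullet> y = y' \<bullet> y'" using assms by (simp add: norm_eq_sqrt_inner)
  \<comment> \<open>Thus the coefficient of \<open>u\<close> in \<open>f y\<close> is 1 and
    \<open>f y = y - u\<close>.\<close>
  then have "2 * (y \<bullet> u) = u \<bullet> u"
    by (simp add: u_def inner_diff_left inner_diff_right inner_commute)
  then have "f y = y'" using u by (simp add: f_def) (simp add: u_def)
  moreover have "f 0 = 0" by (simp add: f_def)
  ultimately show ?thesis using emeasure_isometry_ball_Int[OF inv iso, of y r 0 s] by simp
qed simp

text \<open>Spheres are null sets. The conventions to be reconciled are the closed balls of
  \<open>lens_vol\<close>, the open ball carrying the daughters and the open sets to which the
  isometry lemmas apply.\<close>

lemma emeasure_lborel_Int_cball:
  fixes a b :: "'a::euclidean_space"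
  shows "emeasure lborel (cball a r \<inter> cball b s) = emeasure lborel (ball a r \<inter> ball b s)"
    and "emeasure lborel (cball a r \<inter> ball b s) = emeasure lborel (ball a r \<inter> ball b s)"
proof -
  have "AE x in lborel. x \<notin> sphere c d" for c :: 'a and d
    by (intro AE_not_in null_setsI)
      (use negligible_sphere[of c d] in \<open>auto simp: negligible_iff_emeasure0 simp del: sphere_def\<close>)
  from this[of a r] this[of b s]
show "emeasure lborel (cball a r \<inter> cball b s) = emeasure lborel (ball a r \<inter> ball b s)"
    "emeasure lborel (cball a r \<inter> ball b s) = emeasure lborel (ball a r \<inter> ball b s)"
    by (auto intro!: emeasure_eq_AE elim!: AE_mp)
qed

text \<open>\<open>lens_vol\<close> centres the ball of radius \<open>r\<close> at 0, whereas the
  daughters put the ball of radius \<open>rd\<close> there. The point reflection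
  \<open>\<lambda>x. ?e - x\<close> exchanges the two centres; afterwards the direction of
  \<open>?e\<close> is turned into that of \<open>y\<close> by radial symmetry.\<close>

lemma lens_vol_norm:
  fixes y :: "'a::euclidean_space"
  shows "lens_vol TYPE('a) r rd (norm y) = measure lborel (cball y r \<inter> ball 0 rd)"
proof -
  define b where "b = (SOME b. b \<in> (Basis :: 'a set))"
  have "b \<in> Basis" unfolding b_def by (rule someI_ex) (use nonempty_Basis in blast)
  then have nb: "norm (norm y *\<^sub>R b) = norm y" by simp
  let ?e = "norm y *\<^sub>R b"
  have "emeasure lborel (cball 0 r \<inter> cball ?e rd) = emeasure lborel (ball 0 r \<inter> ball ?e rd)"
    by (rule emeasure_lborel_Int_cball)
  also have "\<dots> = emeasure lborel (ball ?e r \<inter> ball 0 rd)"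
    using emeasure_isometry_ball_Int[of "\<lambda>x. ?e - x" 0 r ?e rd] by (simp add: dist_norm norm_minus_commute)
  also have "\<dots> = emeasure lborel (ball y r \<inter> ball 0 rd)"
    by (rule emeasure_ball_Int_radial) (rule nb)
  also have "\<dots> = emeasure lborel (cball y r \<inter> ball 0 rd)"
    by (rule emeasure_lborel_Int_cball(2)[symmetric])
  finally show ?thesis
    unfolding lens_vol_def b_def[symmetric] by (simp add: measure_def)
qed

text \<open>Polar coordinates in the form needed here. Half-lines determine a measure on the reals,
  and on \<open>{..t}\<close> both sides give the volume of the ball of radius \<open>t\<close>,
  whose derivative in \<open>t\<close> is the density.\<close>

lemma distr_norm_lborel:
  "distr (lborel :: 'a::euclidean_space measure) borel norm =
    density lborel (\<lambda>t. ennreal (real DIM('a) * unit_ball_vol (real DIM('a)) * t ^ (DIM('a) - 1)) * indicator {0..} t)"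
  (is "?D = density lborel ?g")
proof (rule measure_eqI_generator_eq)
  let ?V = "unit_ball_vol (real DIM('a))"
  show "Int_stable (range atMost :: real set set)"
    by (auto simp: Int_stable_def Int_atMost)
  show "sets ?D = sigma_sets UNIV (range atMost)"
    by (simp, subst borel_eq_atMost) (rule sets_measure_of, simp)
  show "sets (density lborel ?g) = sigma_sets UNIV (range atMost)"
    by (simp, subst borel_eq_atMost) (rule sets_measure_of, simp)
  have D: "emeasure ?D {..t} = (if t < 0 then 0 else ennreal (?V * t ^ DIM('a)))" for t :: real
  proof -
    have "emeasure ?D {..t} = emeasure lborel (cball (0::'a) t)"
      by (subst emeasure_distr) (auto intro!: arg_cong[where f="emeasure lborel"])
    then show ?thesis by (auto simp: emeasure_cball)
  qed
  then show "emeasure ?D ((\<lambda>k::nat. {..real k}) k) \<noteq> \<infinity>" for k by simp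
  show "(\<Union>k::nat. {..real k}) = UNIV" using real_arch_simple by auto
  fix X assume "X \<in> range (atMost :: real \<Rightarrow> _)"
  then obtain t where X: "X = {..t}" by auto
  have "emeasure (density lborel ?g) {..t} = (if t < 0 then 0 else ennreal (?V * t ^ DIM('a)))"
  proof (cases "t < 0")
    case True
    have "emeasure (density lborel ?g) {..t} = (\<integral>\<^sup>+s. ?g s * indicator {..t} s \<partial>lborel)"
      by (simp add: emeasure_density)
    also have "\<dots> = (\<integral>\<^sup>+s. 0 \<partial>(lborel :: real measure))"
      using True by (intro nn_integral_cong) (auto split: split_indicator)
    finally show ?thesis using True by simp
  next
    case False
    have "emeasure (density lborel ?g) {..t} = (\<integral>\<^sup>+s. ?g s * indicator {..t} s \<partial>lborel)"
      by (simp add: emeasure_density)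
    also have "\<dots> = (\<integral>\<^sup>+s. ennreal (real DIM('a) * ?V * s ^ (DIM('a) - 1)) * indicator {0..t} s \<partial>lborel)"
      by (intro nn_integral_cong) (auto split: split_indicator)
    also have "\<dots> = ennreal (?V * t ^ DIM('a) - ?V * 0 ^ DIM('a))"
      using False by (intro nn_integral_FTC_Icc) (auto intro!: derivative_eq_intros)
    finally show ?thesis using False by simp
  qed
  then show "emeasure ?D X = emeasure (density lborel ?g) X" using D X by simp
qed auto

lemma nn_integral_ball_radial:
  fixes w :: "real \<Rightarrow> ennreal"
  assumes w[measurable]: "w \<in> borel_measurable borel"
  shows "(\<integral>\<^sup>+y. w (norm y) * indicator (ball 0 R) y \<partial>(lborel :: 'a::euclidean_space measure)) =
    (\<integral>\<^sup>+t. w t * ennreal (real DIM('a) * unit_ball_vol (real DIM('a)) * t ^ (DIM('a) - 1)) * indicator {0..R} t \<partial>lborel)"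
proof -
  have "(\<integral>\<^sup>+y. w (norm y) * indicator (ball 0 R) y \<partial>(lborel :: 'a measure)) =
     (\<integral>\<^sup>+y. w (norm y) * indicator {..<R} (norm y) \<partial>(lborel :: 'a measure))"
    by (intro nn_integral_cong) (auto split: split_indicator)
  also have "\<dots> = (\<integral>\<^sup>+t. w t * indicator {..<R} t \<partial>distr (lborel :: 'a measure) borel norm)"
    by (subst nn_integral_distr) auto
  also have "\<dots> = (\<integral>\<^sup>+t. ennreal (real DIM('a) * unit_ball_vol (real DIM('a)) * t ^ (DIM('a) - 1)) * indicator {0..} t *
      (w t * indicator {..<R} t) \<partial>lborel)"
    unfolding distr_norm_lborel by (subst nn_integral_density) auto
  also have "\<dots> = (\<integral>\<^sup>+t. w t * ennreal (real DIM('a) * unit_ball_vol (real DIM('a)) * t ^ (DIM('a) - 1)) * indicator {0..R} t \<partial>lborel)"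
  proof (rule nn_integral_cong_AE)
    \<comment> \<open>The open ball yields \<open>t < R\<close> but the target interval is closed;
      the endpoint is null.\<close>
    have "AE t in lborel. t \<noteq> R" by (rule AE_lborel_singleton)
    then show "AE t in lborel. ennreal (real DIM('a) * unit_ball_vol (real DIM('a)) * t ^ (DIM('a) - 1)) * indicator {0..} t *
      (w t * indicator {..<R} t) = w t * ennreal (real DIM('a) * unit_ball_vol (real DIM('a)) * t ^ (DIM('a) - 1)) * indicator {0..R} t"
      by eventually_elim (auto split: split_indicator simp: mult_ac)
  qed
  finally show ?thesis .
qed

text \<open>As a function of the distance it measures the sections of a measurable set of pairs, so
  measurability comes from that of parametrised integrals.\<close>

lemma borel_measurable_lens_vol [measurable]:
  "lens_vol TYPE('a::euclidean_space) r rd \<in> borel_measurable borel"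
proof -
  define b where "b = (SOME b. b \<in> (Basis :: 'a set))"
  have "lens_vol TYPE('a) r rd x =
      enn2real (\<integral>\<^sup>+z. indicator {p \<in> space (borel \<Otimes>\<^sub>M lborel). dist 0 (snd p) \<le> r \<and> dist (fst p *\<^sub>R b) (snd p) \<le> rd} (x, z) \<partial>lborel)" for x
  proof -
    have "lens_vol TYPE('a) r rd x = measure lborel (cball 0 r \<inter> cball (x *\<^sub>R b) rd)"
      unfolding lens_vol_def b_def[symmetric] by simp
    also have "\<dots> = enn2real (\<integral>\<^sup>+z. indicator (cball 0 r \<inter> cball (x *\<^sub>R b) rd) z \<partial>lborel)"
      by (simp add: measure_def)
    also have "(\<integral>\<^sup>+z. indicator (cball 0 r \<inter> cball (x *\<^sub>R b) rd) z \<partial>lborel) =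
        (\<integral>\<^sup>+z. indicator {p \<in> space (borel \<Otimes>\<^sub>M lborel). dist 0 (snd p) \<le> r \<and> dist (fst p *\<^sub>R b) (snd p) \<le> rd} (x, z) \<partial>lborel)"
      by (intro nn_integral_cong) (auto simp: indicator_def space_pair_measure)
    finally show ?thesis .
  qed
  then show ?thesis by (subst measurable_cong) (assumption, measurable)
qed

text \<open>After the passage to polar coordinates the Lebesgue integral still has to become the
  gauge \<open>integral\<close> of the final formula. That is possible because the integrand is
  bounded by \<open>rd ^ (DIM('a) - 1)\<close> on a bounded interval.\<close>

lemma nn_integral_ball_lens:
  assumes "0 \<le> ld" and rd: "0 < rd"
  shows "(\<integral>\<^sup>+y. ennreal (exp (- ld * measure lborel (cball y r \<inter> ball 0 rd))) * indicator (ball 0 rd) y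
      \<partial>(lborel :: 'a::euclidean_space measure)) =
    ennreal (real DIM('a) * unit_ball_vol (real DIM('a)) *
      integral {0..rd} (\<lambda>x. exp (- ld * lens_vol TYPE('a) r rd x) * x ^ (DIM('a) - 1)))"
proof -
  let ?V = "unit_ball_vol (real DIM('a))"
  let ?w = "\<lambda>t. exp (- ld * lens_vol TYPE('a) r rd t)"
  let ?h = "\<lambda>t. (?w t * t ^ (DIM('a) - 1)) * indicator {0..rd} t"
  have "(\<integral>\<^sup>+y. ennreal (exp (- ld * measure lborel (cball y r \<inter> ball 0 rd))) * indicator (ball 0 rd) y
      \<partial>(lborel :: 'a measure)) = (\<integral>\<^sup>+y. ennreal (?w (norm y)) * indicator (ball 0 rd) y \<partial>(lborel :: 'a measure))"
    by (simp add: lens_vol_norm)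
  also have "\<dots> = (\<integral>\<^sup>+t. ennreal (?w t) * ennreal (real DIM('a) * ?V * t ^ (DIM('a) - 1)) * indicator {0..rd} t \<partial>lborel)"
    by (rule nn_integral_ball_radial) measurable
  also have "\<dots> = (\<integral>\<^sup>+t. ennreal (real DIM('a) * ?V) * ennreal (?h t) \<partial>lborel)"
    by (intro nn_integral_cong) (auto split: split_indicator simp: mult_ac simp flip: ennreal_mult)
  also have "\<dots> = ennreal (real DIM('a) * ?V) * (\<integral>\<^sup>+t. ennreal (?h t) \<partial>lborel)"
    by (rule nn_integral_cmult) measurable
  also have "(\<integral>\<^sup>+t. ennreal (?h t) \<partial>lborel) = ennreal (integral {0..rd} (\<lambda>x. ?w x * x ^ (DIM('a) - 1)))"
  proof -
    have w1: "?w t \<le> 1" for t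
      using assms(1) by (simp add: lens_vol_def)
    have int: "integrable lborel ?h"
    proof (rule integrableI_bounded_set[where A="{0..rd}" and B="rd ^ (DIM('a) - 1)"])
      show "AE x in lborel. x \<in> {0..rd} \<longrightarrow> norm (?h x) \<le> rd ^ (DIM('a) - 1)"
      proof (intro AE_I2 impI)
        fix x assume "x \<in> {0..rd}"
        then have "?w x * x ^ (DIM('a) - 1) \<le> 1 * rd ^ (DIM('a) - 1)"
          by (intro mult_mono w1 power_mono) auto
        then show "norm (?h x) \<le> rd ^ (DIM('a) - 1)" using \<open>x \<in> {0..rd}\<close> by (simp add: abs_mult)
      qed
    qed (use rd in \<open>auto simp: emeasure_lborel_Icc\<close>)
    then have si: "set_integrable lborel {0..rd} (\<lambda>x. ?w x * x ^ (DIM('a) - 1))"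
      by (simp add: set_integrable_def mult_ac)
    have "(\<integral>\<^sup>+t. ennreal (?h t) \<partial>lborel) = ennreal (\<integral>t. ?h t \<partial>lborel)"
      by (rule nn_integral_eq_integral[OF int]) (auto split: split_indicator)
    also have "(\<integral>t. ?h t \<partial>lborel) = (LINT t:{0..rd}|lborel. ?w t * t ^ (DIM('a) - 1))"
      by (simp add: set_lebesgue_integral_def mult_ac)
    also have "\<dots> = integral {0..rd} (\<lambda>x. ?w x * x ^ (DIM('a) - 1))"
      by (rule set_borel_integral_eq_integral(2)[OF si])
    finally show ?thesis .
  qed
  finally show ?thesis by (simp add: ennreal_mult')
qed

section \<open>The cluster process\<close>

text \<open>One shape for both intensities: \<open>A\<close> is the whole space for the parents and
  the cluster ball for the daughters. It is built on \<open>lborel\<close> so that its sigma-algebra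
  is the Borel one.\<close>

definition scaled_lebesgue :: "real \<Rightarrow> 'a::euclidean_space set \<Rightarrow> 'a measure" where
  "scaled_lebesgue c A = density lborel (\<lambda>x. ennreal c * indicator A x)"

lemma sets_scaled_lebesgue [simp, measurable_cong]: "sets (scaled_lebesgue c A) = sets borel"
  by (simp add: scaled_lebesgue_def)

lemma space_scaled_lebesgue [simp]: "space (scaled_lebesgue c A) = UNIV"
  by (simp add: scaled_lebesgue_def)

lemma emeasure_scaled_lebesgue:
  assumes "A \<in> sets borel" "B \<in> sets borel"
  shows "emeasure (scaled_lebesgue c A) B = ennreal c * emeasure lborel (B \<inter> A)"
proof -
  have "emeasure (scaled_lebesgue c A) B = (\<integral>\<^sup>+x. ennreal c * indicator A x * indicator B x \<partial>lborel)"
    unfolding scaled_lebesgue_def using assms by (subst emeasure_density) auto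
  also have "\<dots> = (\<integral>\<^sup>+x. ennreal c * indicator (B \<inter> A) x \<partial>lborel)"
    by (intro nn_integral_cong) (auto split: split_indicator)
  also have "\<dots> = ennreal c * emeasure lborel (B \<inter> A)"
    using assms by (intro nn_integral_cmult_indicator) auto
  finally show ?thesis .
qed

lemma measure_scaled_lebesgue:
  assumes "A \<in> sets borel" "B \<in> sets borel" "0 \<le> c"
  shows "measure (scaled_lebesgue c A) B = c * measure lebesgue (B \<inter> A)"
  using assms by (simp add: measure_def emeasure_scaled_lebesgue enn2real_mult)

lemma emeasure_scaled_lebesgue_finite:
  assumes "A \<in> sets borel" "B \<in> sets borel" "bounded (B \<inter> A)"
  shows "emeasure (scaled_lebesgue c A) B < \<infinity>"
  using assms emeasure_bounded_finite[of "B \<inter> A"]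
  by (simp add: emeasure_scaled_lebesgue ennreal_mult_less_top)

lemma sigma_finite_scaled_lebesgue:
  assumes "A \<in> sets (borel :: 'a::euclidean_space measure)"
  shows "sigma_finite_measure (scaled_lebesgue c A)"
proof
  have "emeasure (scaled_lebesgue c A) (ball 0 (real k)) \<noteq> \<infinity>" for k
    using emeasure_scaled_lebesgue_finite[OF assms, of "ball 0 (real k)" c]
    by (simp add: bounded_Int less_top)
  then show "\<exists>F. countable F \<and> F \<subseteq> sets (scaled_lebesgue c A) \<and> \<Union>F = space (scaled_lebesgue c A) \<and>
      (\<forall>a\<in>F. emeasure (scaled_lebesgue c A) a \<noteq> \<infinity>)"
    using UN_ball_nat[where 'a='a]
    by (intro exI[of _ "range (\<lambda>k::nat. ball 0 (real k))"]) auto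
qed

lemma nn_integral_scaled_lebesgue:
  assumes [measurable]: "A \<in> sets borel" "f \<in> borel_measurable borel"
  shows "(\<integral>\<^sup>+x. f x \<partial>scaled_lebesgue c A) = ennreal c * (\<integral>\<^sup>+x. f x * indicator A x \<partial>lborel)"
proof -
  have "(\<integral>\<^sup>+x. f x \<partial>scaled_lebesgue c A) = (\<integral>\<^sup>+x. ennreal c * indicator A x * f x \<partial>lborel)"
    unfolding scaled_lebesgue_def by (subst nn_integral_density) auto
  also have "\<dots> = (\<integral>\<^sup>+x. ennreal c * (f x * indicator A x) \<partial>lborel)"
    by (simp add: mult_ac)
  also have "\<dots> = ennreal c * (\<integral>\<^sup>+x. f x * indicator A x \<partial>lborel)"
    by (rule nn_integral_cmult) measurable
  finally show ?thesis .
qed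

text \<open>\<open>poisson_pp\<close> evaluates its intensity at bounded Borel sets only. This
  allows the set functions in the definition of the process to be replaced by measures on the Borel
  sets.\<close>

lemma poisson_pp_cong:
  assumes "\<And>B. B \<in> sets borel \<Longrightarrow> bounded B \<Longrightarrow> Lam B = Lam' B" and "poisson_pp M N Lam"
  shows "poisson_pp M N Lam'"
  using assms(2) unfolding poisson_pp_def by (simp add: assms(1))

text \<open>Note that \<open>exp_neg \<top> = 1\<close>; it is only applied to sums that are finite on locally finite configurations.\<close>

definition exp_neg :: "ennreal \<Rightarrow> ennreal" where
  "exp_neg s = ennreal (exp (- enn2real s))"

lemma measurable_exp_neg [measurable]: "exp_neg \<in> borel_measurable borel"
  unfolding exp_neg_def by measurable

text \<open>The parameter space is kept arbitrary because the event is needed on the sample space,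
  on the product of the two sequence spaces, and with the location of a daughter as an extra
  coordinate.\<close>

lemma measurable_avoid:
  fixes x :: "nat \<Rightarrow> 'p \<Rightarrow> 'a::euclidean_space"
  assumes [measurable]: "z \<in> borel_measurable N"
    "\<And>j. j \<in> J \<Longrightarrow> x j \<in> borel_measurable N"
    and d: "\<And>j. j \<in> J \<Longrightarrow> d j \<in> measurable N cfg_space"
  shows "Measurable.pred N (\<lambda>p. \<forall>j\<in>J. \<forall>y\<in>d j p. \<not> dist (z p) (x j p + y) \<le> r)"
proof -
  have "Measurable.pred N (\<lambda>p. \<forall>y\<in>d j p. \<not> dist (z p) (x j p + y) \<le> r)" if j: "j \<in> J" for j
  proof (rule measurable_void_pred[OF _ d[OF j]])
    note assms(2)[OF j, measurable]
    show "Measurable.pred (borel \<Otimes>\<^sub>M N) (\<lambda>(y, p). dist (z p) (x j p + y) \<le> r)"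
      by measurable
  qed
  then show ?thesis by (intro pred_intros_countable_bounded) auto
qed

locale cluster_process = prob_space M for M :: "'w measure" +
  fixes X :: "nat \<Rightarrow> 'w \<Rightarrow> 'a::euclidean_space" and D :: "nat \<Rightarrow> 'w \<Rightarrow> 'a set"
    and Phi :: "'w \<Rightarrow> 'a set" and lp ld rd :: real
  assumes lp: "0 < lp" and ld: "0 < ld" and rd: "0 < rd"
    and measurable_X [measurable]: "\<And>i. X i \<in> borel_measurable M"
    and inj_X: "\<And>\<omega>. \<omega> \<in> space M \<Longrightarrow> inj (\<lambda>i. X i \<omega>)"
    and parents: "poisson_pp M (\<lambda>\<omega>. range (\<lambda>i. X i \<omega>)) (\<lambda>B. lp * measure lebesgue B)"
    and daughters: "\<And>i. poisson_pp M (D i) (\<lambda>B. ld * measure lebesgue (B \<inter> ball 0 rd))"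
    and indep_D: "indep_vars (\<lambda>_. cfg_space) D UNIV"
    and measurable_Xs [measurable]: "(\<lambda>\<omega> i. X i \<omega>) \<in> measurable M (Pi\<^sub>M UNIV (\<lambda>_. borel))"
    and measurable_Ds [measurable]: "(\<lambda>\<omega> i. D i \<omega>) \<in> measurable M (Pi\<^sub>M UNIV (\<lambda>_. cfg_space))"
    and indep_XD: "indep_set
          (sigma_sets (space M) {(\<lambda>\<omega> i. X i \<omega>) -` A \<inter> space M | A. A \<in> sets (Pi\<^sub>M UNIV (\<lambda>_. borel))})
          (sigma_sets (space M) {(\<lambda>\<omega> i. D i \<omega>) -` A \<inter> space M | A. A \<in> sets (Pi\<^sub>M UNIV (\<lambda>_. cfg_space))})"
    and Phi: "\<And>\<omega>. \<omega> \<in> space M \<Longrightarrow> Phi \<omega> = (\<Union>i. (\<lambda>y. X i \<omega> + y) ` D i \<omega>)"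
begin

abbreviation "Lp \<equiv> scaled_lebesgue lp (UNIV :: 'a set)"
abbreviation "Ld \<equiv> scaled_lebesgue ld (ball (0::'a) rd)"
abbreviation "P \<omega> \<equiv> range (\<lambda>i. X i \<omega>)"

sublocale P: poisson_config M P Lp
proof
  show "poisson_pp M P (measure Lp)"
    by (rule poisson_pp_cong[OF _ parents]) (use lp in \<open>simp add: measure_scaled_lebesgue\<close>)
qed (use emeasure_scaled_lebesgue_finite[of UNIV _ lp] in \<open>auto simp: bounded_Int\<close>)

sublocale D: poisson_config M "D i" Ld for i
proof
  show "poisson_pp M (D i) (measure Ld)"
    by (rule poisson_pp_cong[OF _ daughters]) (use ld in \<open>simp add: measure_scaled_lebesgue\<close>)
qed (use emeasure_scaled_lebesgue_finite[of "ball 0 rd" _ ld] in \<open>auto simp: bounded_Int\<close>)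

sublocale Lp: sigma_finite_measure Lp by (rule sigma_finite_scaled_lebesgue) simp

sublocale Ld: sigma_finite_measure Ld by (rule sigma_finite_scaled_lebesgue) simp

text \<open>The substitute for conditioning on the parents: they are frozen at
  \<open>\<omega>\<close> while the daughters are averaged over \<open>\<omega>'\<close>.\<close>

lemma decouple_parents_daughters:
  assumes "f \<in> borel_measurable (Pi\<^sub>M UNIV (\<lambda>_. borel) \<Otimes>\<^sub>M Pi\<^sub>M UNIV (\<lambda>_. cfg_space))"
  shows "(\<integral>\<^sup>+\<omega>. f ((\<lambda>i. X i \<omega>), (\<lambda>i. D i \<omega>)) \<partial>M) =
    (\<integral>\<^sup>+\<omega>. \<integral>\<^sup>+\<omega>'. f ((\<lambda>i. X i \<omega>), (\<lambda>i. D i \<omega>')) \<partial>M \<partial>M)"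
proof (rule nn_integral_decouple)
  fix A B
  assume "A \<in> sets (Pi\<^sub>M UNIV (\<lambda>_::nat. borel :: 'a measure))" "B \<in> sets (Pi\<^sub>M UNIV (\<lambda>_::nat. cfg_space :: 'a set measure))"
  then show "prob (((\<lambda>\<omega> i. X i \<omega>) -` A \<inter> space M) \<inter> ((\<lambda>\<omega> i. D i \<omega>) -` B \<inter> space M)) =
    prob ((\<lambda>\<omega> i. X i \<omega>) -` A \<inter> space M) * prob ((\<lambda>\<omega> i. D i \<omega>) -` B \<inter> space M)"
    by (intro indep_setD[OF indep_XD] sigma_sets.Basic) auto
qed (use assms in auto)

lemma decouple_daughter:
  fixes i :: nat
  assumes "f \<in> borel_measurable (Pi\<^sub>M {i} (\<lambda>_. cfg_space) \<Otimes>\<^sub>M Pi\<^sub>M (- {i}) (\<lambda>_. cfg_space))"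
  shows "(\<integral>\<^sup>+\<omega>. f ((\<lambda>j\<in>{i}. D j \<omega>), (\<lambda>j\<in>- {i}. D j \<omega>)) \<partial>M) =
    (\<integral>\<^sup>+\<omega>. \<integral>\<^sup>+\<omega>'. f ((\<lambda>j\<in>{i}. D j \<omega>), (\<lambda>j\<in>- {i}. D j \<omega>')) \<partial>M \<partial>M)"
  by (rule indep_var_decouple[OF indep_var_restrict[OF indep_D] assms]) auto

text \<open>Poisson counts outside the cluster ball have mean 0 and so vanish almost surely. Since
  counts are specified for bounded sets only, the exterior is exhausted by countably many bounded
  shells.\<close>

lemma AE_daughters_in_ball: "AE \<omega> in M. \<forall>i. D i \<omega> \<subseteq> ball 0 rd"
proof -
  have "AE \<omega> in M. D i \<omega> \<inter> (ball 0 (real k) - ball 0 rd) = {}" for i and k :: nat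
  proof -
    let ?B = "ball 0 (real k) - ball (0::'a) rd"
    have B: "?B \<in> sets borel" "bounded ?B" by (auto intro: bounded_subset)
    have "?B \<inter> ball 0 rd = {}" by blast
    then have "measure Ld ?B = 0" using ld B by (simp add: measure_scaled_lebesgue)
    then have "prob {\<omega> \<in> space M. D i \<omega> \<inter> ?B = {}} = 1" using D.void_prob[OF B, of i] by simp
    then show ?thesis by (rule AE_prob_1[THEN AE_mp]) auto
  qed
  then have "AE \<omega> in M. \<forall>i. \<forall>k::nat. D i \<omega> \<inter> (ball 0 (real k) - ball 0 rd) = {}"
    by (simp add: AE_all_countable)
  then show ?thesis
  proof eventually_elim
    case (elim \<omega>)
    have "y \<in> ball 0 rd" if "y \<in> D i \<omega>" for i y
    proof -
      obtain k :: nat where "y \<in> ball 0 (real k)" using UN_ball_nat by blast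
      then show ?thesis using elim that by blast
    qed
    then show ?case by blast
  qed
qed

text \<open>A single point has intensity 0, so its void probability is
  \<open>exp 0 = 1\<close>.\<close>

lemma AE_not_daughter: "AE \<omega> in M. a \<notin> D i \<omega>"
proof -
  have "emeasure lborel ({a} \<inter> ball 0 rd) \<le> emeasure lborel {a}" by (intro emeasure_mono) auto
  then have "measure Ld {a} = 0" by (simp add: measure_def emeasure_scaled_lebesgue)
  then have "prob {\<omega> \<in> space M. D i \<omega> \<inter> {a} = {}} = 1" using D.void_prob[of "{a}" i] by simp
  then show ?thesis by (rule AE_prob_1[THEN AE_mp]) auto
qed

section \<open>Void probabilities of the clusters for given parents\<close>

definition hit :: "real \<Rightarrow> 'a \<Rightarrow> real" where
  "hit r w = measure Ld (cball w r)"

text \<open>The sum is taken over the parent set rather than over indices, so that the Mecke formula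
  and the translation of the parents act on it directly.\<close>

definition total_hit :: "real \<Rightarrow> 'a \<Rightarrow> 'a set \<Rightarrow> ennreal" where
  "total_hit r z \<phi> = (\<integral>\<^sup>+x. ennreal (hit r (z - x)) \<partial>count_space \<phi>)"

lemma hit_eq: "hit r w = ld * measure lborel (cball w r \<inter> ball 0 rd)"
  unfolding hit_def using ld by (subst measure_scaled_lebesgue) auto

lemma hit_nonneg [simp]: "0 \<le> hit r w"
  by (simp add: hit_def)

text \<open>By the triangle inequality the two balls are then disjoint. Consequently only the
  finitely many parents near \<open>z\<close> contribute to \<open>total_hit\<close> when the
  parents are locally finite.\<close>

lemma hit_far: "norm w \<ge> r + rd \<Longrightarrow> hit r w = 0"
proof -
  assume w: "norm w \<ge> r + rd"
  have "cball w r \<inter> ball 0 rd = {}"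
  proof (rule ccontr)
    assume "cball w r \<inter> ball 0 rd \<noteq> {}"
    then obtain y where "dist w y \<le> r" "norm y < rd" by (auto simp: dist_norm)
    then show False using w norm_triangle_sub[of w y] by (simp add: dist_norm)
  qed
  then show "hit r w = 0" by (simp add: hit_eq)
qed

lemma measurable_hit [measurable]: "hit r \<in> borel_measurable borel"
proof -
  have "hit r w = enn2real (\<integral>\<^sup>+y. indicator {p. dist (fst p) (snd p) \<le> r} (w, y) \<partial>Ld)" for w
  proof -
    have "(\<integral>\<^sup>+y. indicator {p. dist (fst p) (snd p) \<le> r} (w, y) \<partial>Ld) = (\<integral>\<^sup>+y. indicator (cball w r) y \<partial>Ld)"
      by (intro nn_integral_cong) (auto simp: indicator_def)
    then show ?thesis by (simp add: hit_def measure_def)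
  qed
  moreover have "(\<lambda>w. enn2real (\<integral>\<^sup>+y. indicator {p::'a \<times> 'a. dist (fst p) (snd p) \<le> r} (w, y) \<partial>Ld)) \<in> borel_measurable borel"
  proof -
    have "{p::'a \<times> 'a. dist (fst p) (snd p) \<le> r} = {p \<in> space (borel \<Otimes>\<^sub>M Ld). dist (fst p) (snd p) \<le> r}"
      by (simp add: space_pair_measure)
    also have "\<dots> \<in> sets (borel \<Otimes>\<^sub>M Ld)" by measurable
    finally have [measurable]: "{p::'a \<times> 'a. dist (fst p) (snd p) \<le> r} \<in> sets (borel \<Otimes>\<^sub>M Ld)" .
    show ?thesis by measurable
  qed
  ultimately show ?thesis by (subst measurable_cong) auto
qed

lemma measurable_total_hit:
  assumes [measurable]: "z \<in> borel_measurable N" and g: "g \<in> measurable N cfg_space"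
  shows "(\<lambda>p. total_hit r (z p) (g p)) \<in> borel_measurable N"
  unfolding total_hit_def
  by (rule measurable_nn_integral_cfg[OF _ g]) (simp add: case_prod_beta)

lemma daughter_void_prob: "prob {\<omega> \<in> space M. D i \<omega> \<inter> cball w r = {}} = exp (- hit r w)"
  unfolding hit_def by (rule D.void_prob) auto

text \<open>Almost surely a parent at distance at least \<open>r + rd\<close> from \<open>z\<close>
  has no daughter within \<open>r\<close> of \<open>z\<close>. Only the finite set \<open>J0\<close>
  of near parents matters, and there independence gives a product of single void probabilities, that
  is, an exponential of a sum.\<close>

lemma prob_clusters_avoid:
  assumes x: "inj x" "range x \<in> lf_configs"
  shows "emeasure M {\<omega> \<in> space M. \<forall>j\<in>J. \<forall>y\<in>D j \<omega>. \<not> dist z (x j + y) \<le> r} = exp_neg (total_hit r z (x ` J))"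
proof -
  define J0 where "J0 = {j\<in>J. norm (z - x j) < r + rd}"
  have "finite J0"
  proof (rule finite_imageD)
    have "x ` J0 \<subseteq> range x \<inter> ball z (r + rd)" by (auto simp: J0_def dist_norm)
    then show "finite (x ` J0)" by (rule finite_subset) (simp add: lf_configs_finite_Int[OF x(2)])
    show "inj_on x J0" using x(1) by (rule inj_on_subset) simp
  qed
  let ?E = "\<lambda>J. {\<omega> \<in> space M. \<forall>j\<in>J. \<forall>y\<in>D j \<omega>. \<not> dist z (x j + y) \<le> r}"
  have E: "?E J \<in> sets M" for J
    using measurable_avoid[of "\<lambda>_. z" M J "\<lambda>j _. x j" D r] by (simp add: pred_def)
  have dist_eq: "dist z (x j + y) = dist (z - x j) y" for j y
    by (simp add: dist_norm algebra_simps)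
  have "emeasure M (?E J) = emeasure M (?E J0)"
  proof (rule emeasure_eq_AE)
    show "AE \<omega> in M. \<omega> \<in> ?E J \<longleftrightarrow> \<omega> \<in> ?E J0"
      using AE_daughters_in_ball
    proof eventually_elim
      case (elim \<omega>)
      have "\<not> dist z (x j + y) \<le> r" if "j \<in> J" "j \<notin> J0" "y \<in> D j \<omega>" for j y
      proof
        assume "dist z (x j + y) \<le> r"
        moreover have "norm y < rd" using elim that(3) by (auto simp: subset_iff)
        ultimately have "norm (z - x j) < r + rd"
          unfolding dist_eq using norm_triangle_sub[of "z - x j" y] by (simp add: dist_norm)
        then show False using that by (simp add: J0_def)
      qed
      then show ?case by (auto simp: J0_def)
    qed
  qed (rule E)+
  \<comment> \<open>The empty product is treated apart because \<open>indep_varsD\<close> asks for a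
    nonempty index set.\<close>
  also have "emeasure M (?E J0) = ennreal (\<Prod>j\<in>J0. exp (- hit r (z - x j)))"
  proof (cases "J0 = {}")
    case True
    then show ?thesis by (simp add: emeasure_space_1)
  next
    case False
    let ?A = "\<lambda>j. void_event (cball (z - x j) r)"
    have A: "D j -` ?A j \<inter> space M = {\<omega> \<in> space M. D j \<omega> \<inter> cball (z - x j) r = {}}" for j
      using D.N_lf by (auto simp: void_event_def)
    have "?E J0 = (\<Inter>j\<in>J0. D j -` ?A j \<inter> space M)"
      unfolding A using False by (auto simp: dist_eq disjoint_iff)
    moreover have "prob (\<Inter>j\<in>J0. D j -` ?A j \<inter> space M) = (\<Prod>j\<in>J0. prob (D j -` ?A j \<inter> space M))"
      by (rule indep_varsD[OF indep_D False \<open>finite J0\<close>]) (auto intro: void_event_sets)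
    ultimately show ?thesis by (simp add: emeasure_eq_measure A daughter_void_prob)
  qed
  also have "(\<Prod>j\<in>J0. exp (- hit r (z - x j))) = exp (- (\<Sum>j\<in>J0. hit r (z - x j)))"
    using \<open>finite J0\<close> by (simp add: exp_sum sum_negf[symmetric])
  also have "ennreal (exp (- (\<Sum>j\<in>J0. hit r (z - x j)))) = exp_neg (total_hit r z (x ` J))"
  proof -
    \<comment> \<open>Distant parents contribute 0 to the full sum by \<open>hit_far\<close>, so
      restricting to \<open>J0\<close> loses nothing on this side either.\<close>
    have "total_hit r z (x ` J) = (\<Sum>a\<in>x ` J0. ennreal (hit r (z - a)))"
      unfolding total_hit_def using \<open>finite J0\<close>
    proof (intro nn_integral_count_space')
      show "ennreal (hit r (z - a)) = 0" if "a \<in> x ` J" "a \<notin> x ` J0" for a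
        using that hit_far[of r "z - a"] by (force simp: J0_def)
    qed (auto simp: J0_def)
    also have "\<dots> = (\<Sum>j\<in>J0. ennreal (hit r (z - x j)))"
      using x(1) by (subst sum.reindex) (auto intro: inj_on_subset)
    also have "\<dots> = ennreal (\<Sum>j\<in>J0. hit r (z - x j))" by simp
    finally show ?thesis by (simp add: exp_neg_def sum_nonneg)
  qed
  finally show ?thesis .
qed

text \<open>This is the probability that \<open>Phi\<close> has no point within \<open>r\<close> of
  \<open>z\<close>, with the daughters already integrated out; see
  \<open>prob_no_point_near\<close>.\<close>

definition avoid_prob :: "real \<Rightarrow> 'a \<Rightarrow> ennreal" where
  "avoid_prob r z = (\<integral>\<^sup>+\<omega>. exp_neg (total_hit r z (P \<omega>)) \<partial>M)"

text \<open>The law of the translated parent process is determined by its void probabilities, and these are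
  translation invariant.\<close>

lemma avoid_prob_stationary: "avoid_prob r z = avoid_prob r 0"
proof -
  have shift_int: "((\<lambda>x. x - z) ` A) \<inter> C = {} \<longleftrightarrow> A \<inter> (\<lambda>x. x - z) -` C = {}" for A C :: "'a set"
    by blast
  have bounded_shift: "bounded ((\<lambda>x. x - z) -` C)" if "bounded C" for C :: "'a set"
  proof -
    have "(\<lambda>x. x - z) -` C = (\<lambda>x. z + x) ` C" by (force simp: image_iff)
    then show ?thesis using bounded_translation[OF that] by simp
  qed
  have lf: "(\<lambda>x. x - z) ` \<phi> \<in> lf_configs" if "\<phi> \<in> lf_configs" for \<phi>
    unfolding lf_configs_def
  proof (intro CollectI allI impI)
    fix B :: "'a set" assume "bounded B"
    have "(\<lambda>x. x - z) ` \<phi> \<inter> B = (\<lambda>x. x - z) ` (\<phi> \<inter> (\<lambda>x. x - z) -` B)" by blast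
    then show "finite ((\<lambda>x. x - z) ` \<phi> \<inter> B)"
      using lf_configs_finite_Int[OF that bounded_shift[OF \<open>bounded B\<close>]] by simp
  qed
  have sets_shift: "(\<lambda>x. x - z) -` C \<in> sets borel" if "C \<in> sets borel" for C :: "'a set"
    using measurable_sets[of "\<lambda>x. x - z" borel borel C] that by simp
  have mQ: "(\<lambda>\<omega>. (\<lambda>x. x - z) ` P \<omega>) \<in> measurable M cfg_space"
  proof (rule measurable_cfg_spaceI)
    show "(\<lambda>x. x - z) ` P \<omega> \<in> lf_configs" if "\<omega> \<in> space M" for \<omega>
      using lf[OF P.N_lf[OF that]] .
    fix C :: "'a set" assume C: "C \<in> sets borel" "bounded C"
    have "P -` void_event ((\<lambda>x. x - z) -` C) \<inter> space M \<in> sets M"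
      using void_event_sets[OF sets_shift[OF C(1)] bounded_shift[OF C(2)]] by (rule measurable_sets[OF P.measurable_N])
    also have "P -` void_event ((\<lambda>x. x - z) -` C) \<inter> space M = {\<omega> \<in> space M. (\<lambda>x. x - z) ` P \<omega> \<inter> C = {}}"
      unfolding shift_int using P.N_lf by (auto simp: void_event_def)
    finally show "{\<omega> \<in> space M. (\<lambda>x. x - z) ` P \<omega> \<inter> C = {}} \<in> sets M" .
  qed
  have law: "distr M cfg_space (\<lambda>\<omega>. (\<lambda>x. x - z) ` P \<omega>) = distr M cfg_space P"
  proof (rule distr_cfg_space_eqI[OF prob_space_axioms mQ P.measurable_N])
    fix C :: "'a set" assume C: "C \<in> sets borel" "bounded C"
    have "emeasure lborel ((\<lambda>x. x - z) -` C) = emeasure (distr lborel borel (\<lambda>x. - z + x)) C"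
      using C by (subst emeasure_distr) (auto simp: vimage_def)
    also have "\<dots> = emeasure lborel C" by (subst lborel_distr_plus) simp
    finally have "measure Lp ((\<lambda>x. x - z) -` C) = measure Lp C"
      using C sets_shift[OF C(1)] lp by (simp add: emeasure_scaled_lebesgue measure_def)
    then show "prob {\<omega> \<in> space M. (\<lambda>x. x - z) ` P \<omega> \<inter> C = {}} = prob {\<omega> \<in> space M. P \<omega> \<inter> C = {}}"
      unfolding shift_int using P.void_prob[OF C] P.void_prob[OF sets_shift[OF C(1)] bounded_shift[OF C(2)]] by simp
  qed
  have m0: "(\<lambda>\<phi>. exp_neg (total_hit r 0 \<phi>)) \<in> borel_measurable cfg_space"
    by (intro measurable_compose[OF _ measurable_exp_neg] measurable_total_hit) auto
  \<comment> \<open>Moving the test point by \<open>z\<close> amounts to moving all parents by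
    \<open>- z\<close>, so only the law of the translated parents is involved.\<close>
  have "total_hit r z \<phi> = total_hit r 0 ((\<lambda>x. x - z) ` \<phi>)" for \<phi>
  proof -
    have "total_hit r 0 ((\<lambda>x. x - z) ` \<phi>) = (\<integral>\<^sup>+x. ennreal (hit r (0 - (x - z))) \<partial>count_space \<phi>)"
      unfolding total_hit_def
      by (rule nn_integral_bij_count_space[symmetric]) (auto simp: bij_betw_def inj_on_def)
    then show ?thesis by (simp add: total_hit_def)
  qed
  then have "avoid_prob r z = (\<integral>\<^sup>+\<omega>. exp_neg (total_hit r 0 ((\<lambda>x. x - z) ` P \<omega>)) \<partial>M)"
    by (simp add: avoid_prob_def)
  also have "\<dots> = (\<integral>\<^sup>+\<phi>. exp_neg (total_hit r 0 \<phi>) \<partial>distr M cfg_space (\<lambda>\<omega>. (\<lambda>x. x - z) ` P \<omega>))"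
    by (rule nn_integral_distr[symmetric, OF mQ]) (simp add: m0)
  also have "\<dots> = avoid_prob r 0"
    unfolding law avoid_prob_def by (rule nn_integral_distr) (auto simp: m0)
  finally show ?thesis .
qed

text \<open>The event is described by a set in the product of the two sequence spaces, to which
  decoupling applies. With the parents frozen, \<open>prob_clusters_avoid\<close> for the full index
  set gives the integrand of \<open>avoid_prob\<close>.\<close>

lemma prob_no_point_near:
  "{\<omega> \<in> space M. \<forall>i. \<forall>y\<in>D i \<omega>. \<not> dist z (X i \<omega> + y) \<le> r} \<in> sets M" (is "?E \<in> _")
  "emeasure M {\<omega> \<in> space M. \<forall>i. \<forall>y\<in>D i \<omega>. \<not> dist z (X i \<omega> + y) \<le> r} = avoid_prob r z"
proof -
  let ?Q = "Pi\<^sub>M UNIV (\<lambda>_::nat. borel :: 'a measure) \<Otimes>\<^sub>M Pi\<^sub>M UNIV (\<lambda>_::nat. cfg_space :: 'a set measure)"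
  let ?S = "{p \<in> space ?Q. \<forall>j\<in>UNIV. \<forall>y\<in>snd p j. \<not> dist z (fst p j + y) \<le> r}"
  have S: "?S \<in> sets ?Q"
    using measurable_avoid[of "\<lambda>_. z" ?Q UNIV "\<lambda>j p. fst p j" "\<lambda>j p. snd p j" r] by (simp add: pred_def)
  have sp: "((\<lambda>i. X i \<omega>), (\<lambda>i. D i \<omega>')) \<in> space ?Q" if "\<omega> \<in> space M" "\<omega>' \<in> space M" for \<omega> \<omega>'
    using measurable_space[OF measurable_Xs that(1)] measurable_space[OF measurable_Ds that(2)]
    by (simp add: space_pair_measure)
  have E: "?E = (\<lambda>\<omega>. ((\<lambda>i. X i \<omega>), (\<lambda>i. D i \<omega>))) -` ?S \<inter> space M" using sp by auto
  show ES: "?E \<in> sets M"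
    unfolding E by (rule measurable_sets[OF _ S]) measurable
  have "emeasure M ?E = (\<integral>\<^sup>+\<omega>. indicator ?S ((\<lambda>i. X i \<omega>), (\<lambda>i. D i \<omega>)) \<partial>M)"
  proof -
    have "emeasure M ?E = (\<integral>\<^sup>+\<omega>. indicator ?E \<omega> \<partial>M)" using ES by simp
    also have "\<dots> = (\<integral>\<^sup>+\<omega>. indicator ?S ((\<lambda>i. X i \<omega>), (\<lambda>i. D i \<omega>)) \<partial>M)"
      using sp by (intro nn_integral_cong) (auto simp: indicator_def)
    finally show ?thesis .
  qed
  also have "\<dots> = (\<integral>\<^sup>+\<omega>. \<integral>\<^sup>+\<omega>'. indicator ?S ((\<lambda>i. X i \<omega>), (\<lambda>i. D i \<omega>')) \<partial>M \<partial>M)"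
    using S by (intro decouple_parents_daughters) simp
  also have "\<dots> = avoid_prob r z"
    unfolding avoid_prob_def
  proof (rule nn_integral_cong)
    fix \<omega> assume \<omega>: "\<omega> \<in> space M"
    let ?F = "{\<omega>' \<in> space M. \<forall>j\<in>UNIV. \<forall>y\<in>D j \<omega>'. \<not> dist z (X j \<omega> + y) \<le> r}"
    have F: "?F \<in> sets M"
      using measurable_avoid[of "\<lambda>_. z" M UNIV "\<lambda>j _. X j \<omega>" D r] by (simp add: pred_def)
    have "(\<integral>\<^sup>+\<omega>'. indicator ?S ((\<lambda>i. X i \<omega>), (\<lambda>i. D i \<omega>')) \<partial>M) = (\<integral>\<^sup>+\<omega>'. indicator ?F \<omega>' \<partial>M)"
      using sp[OF \<omega>] by (intro nn_integral_cong) (auto simp: indicator_def)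
    also have "\<dots> = emeasure M ?F" using F by simp
    also have "\<dots> = exp_neg (total_hit r z (P \<omega>))"
      by (rule prob_clusters_avoid[OF inj_X[OF \<omega>] P.N_lf[OF \<omega>]])
    finally show "(\<integral>\<^sup>+\<omega>'. indicator ?S ((\<lambda>i. X i \<omega>), (\<lambda>i. D i \<omega>')) \<partial>M) = exp_neg (total_hit r z (P \<omega>))" .
  qed
  finally show "emeasure M ?E = avoid_prob r z" .
qed

end

section \<open>The expected number of isolated points\<close>

context cluster_process
begin

text \<open>Counts the isolated points of cluster \<open>i\<close> in the unit window. The indicator
  is split by origin of the neighbour: the first factor depends on cluster \<open>i\<close> alone,
  the second, once \<open>y\<close> is fixed, on the daughters of the other clusters alone, so the
  two can be averaged separately.\<close>

definition isolated_daughters :: "real \<Rightarrow> nat \<Rightarrow> (nat \<Rightarrow> 'a) \<Rightarrow> (nat \<Rightarrow> 'a set) \<Rightarrow> ennreal" where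
  "isolated_daughters r i x d = (\<integral>\<^sup>+y.
     (if (\<forall>y'\<in>d i. \<not> (y' \<noteq> y \<and> dist y y' \<le> r)) then indicator (ball 0 1) (x i + y) else 0) *
     (if (\<forall>j\<in>- {i}. \<forall>y'\<in>d j. \<not> dist (x i + y) (x j + y') \<le> r) then 1 else 0) \<partial>count_space (d i))"

text \<open>Coincidence with a point of cluster \<open>j\<close> is phrased as failure to keep a
  distance above 0, over a one-element index set, so that \<open>measurable_avoid\<close> covers
  it.\<close>

definition collisions :: "nat \<Rightarrow> nat \<Rightarrow> (nat \<Rightarrow> 'a) \<Rightarrow> (nat \<Rightarrow> 'a set) \<Rightarrow> ennreal" where
  "collisions i j x d = (\<integral>\<^sup>+y.
     (if (\<forall>k\<in>{j}. \<forall>y'\<in>d k. \<not> dist (x i + y) (x k + y') \<le> 0) then 0 else 1) \<partial>count_space (d i))"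

lemma measurable_isolated_daughters:
  assumes xs: "\<And>j. (\<lambda>p. xs p j) \<in> borel_measurable N"
    and ds: "\<And>j. (\<lambda>p. ds p j) \<in> measurable N cfg_space"
  shows "(\<lambda>p. isolated_daughters r i (xs p) (ds p)) \<in> borel_measurable N"
  unfolding isolated_daughters_def
proof (rule measurable_nn_integral_cfg[OF _ ds])
  note xs[measurable]
  have dsnd: "(\<lambda>q. ds (snd q) j) \<in> measurable (borel \<Otimes>\<^sub>M N) cfg_space" for j
    by (rule measurable_compose[OF measurable_snd ds])
  have [measurable]: "Measurable.pred (borel \<Otimes>\<^sub>M N) (\<lambda>q. \<forall>y'\<in>ds (snd q) i. \<not> (y' \<noteq> fst q \<and> dist (fst q) y' \<le> r))"
    by (rule measurable_void_pred[OF _ dsnd]) measurable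
  have [measurable]: "Measurable.pred (borel \<Otimes>\<^sub>M N)
      (\<lambda>q. \<forall>j\<in>- {i}. \<forall>y'\<in>ds (snd q) j. \<not> dist (xs (snd q) i + fst q) (xs (snd q) j + y') \<le> r)"
    by (rule measurable_avoid[OF _ _ dsnd]) measurable
  have [measurable]: "Measurable.pred (borel \<Otimes>\<^sub>M N) (\<lambda>q. xs (snd q) i + fst q \<in> ball 0 1)"
    unfolding mem_ball by measurable
  show "(\<lambda>(y, p). (if (\<forall>y'\<in>ds p i. \<not> (y' \<noteq> y \<and> dist y y' \<le> r)) then indicator (ball 0 1) (xs p i + y) else 0) *
     (if (\<forall>j\<in>- {i}. \<forall>y'\<in>ds p j. \<not> dist (xs p i + y) (xs p j + y') \<le> r) then 1 else 0) :: ennreal)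
     \<in> borel_measurable (borel \<Otimes>\<^sub>M N)"
    unfolding case_prod_beta by measurable
qed

lemma measurable_collisions:
  assumes xs: "\<And>j. (\<lambda>p. xs p j) \<in> borel_measurable N"
    and ds: "\<And>j. (\<lambda>p. ds p j) \<in> measurable N cfg_space"
  shows "(\<lambda>p. collisions i j (xs p) (ds p)) \<in> borel_measurable N"
  unfolding collisions_def
proof (rule measurable_nn_integral_cfg[OF _ ds])
  note xs[measurable]
  have dsnd: "(\<lambda>q. ds (snd q) j) \<in> measurable (borel \<Otimes>\<^sub>M N) cfg_space" for j
    by (rule measurable_compose[OF measurable_snd ds])
  have [measurable]: "Measurable.pred (borel \<Otimes>\<^sub>M N)
      (\<lambda>q. \<forall>k\<in>{j}. \<forall>y'\<in>ds (snd q) k. \<not> dist (xs (snd q) i + fst q) (xs (snd q) k + y') \<le> 0)"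
    by (rule measurable_avoid[OF _ _ dsnd]) measurable
  show "(\<lambda>(y, p). (if (\<forall>k\<in>{j}. \<forall>y'\<in>ds p k. \<not> dist (xs p i + y) (xs p k + y') \<le> 0) then 0 else 1) :: ennreal)
     \<in> borel_measurable (borel \<Otimes>\<^sub>M N)"
    unfolding case_prod_beta by measurable
qed

text \<open>The two independent parts are families on \<open>{i}\<close> and on its complement; here
  they are glued back into one family, so that a functional of all clusters can be treated with
  cluster \<open>i\<close> frozen and the others averaged.\<close>

lemma decouple_daughter_split:
  fixes f :: "(nat \<Rightarrow> 'a set) \<Rightarrow> ennreal"
  assumes f: "(\<lambda>p. f (\<lambda>j. if j = i then fst p i else snd p j)) \<in>
    borel_measurable (Pi\<^sub>M {i} (\<lambda>_. cfg_space) \<Otimes>\<^sub>M Pi\<^sub>M (- {i}) (\<lambda>_. cfg_space))"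
  shows "(\<integral>\<^sup>+\<omega>. f (\<lambda>j. D j \<omega>) \<partial>M) = (\<integral>\<^sup>+\<omega>. \<integral>\<^sup>+\<omega>'. f (\<lambda>j. if j = i then D i \<omega> else D j \<omega>') \<partial>M \<partial>M)"
proof -
  have eq: "(\<lambda>j. if j = i then (\<lambda>j\<in>{i}. D j \<omega>) i else (\<lambda>j\<in>- {i}. D j \<omega>') j) =
      (\<lambda>j. if j = i then D i \<omega> else D j \<omega>')" for \<omega> \<omega>'
    by (rule ext) simp
  have "(\<lambda>j. if j = i then D i \<omega> else D j \<omega>) = (\<lambda>j. D j \<omega>)" for \<omega> by (rule ext) simp
  then show ?thesis using decouple_daughter[OF f] by (simp only: fst_conv snd_conv eq)
qed

lemma measurable_split_component:
  "(\<lambda>p. if j = i then fst p i else snd p j) \<in>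
    measurable (Pi\<^sub>M {i} (\<lambda>_. cfg_space) \<Otimes>\<^sub>M Pi\<^sub>M (- {i}) (\<lambda>_. cfg_space)) (cfg_space :: 'a set measure)"
  by (cases "j = i")
     (auto intro!: measurable_compose[OF measurable_fst measurable_component_singleton]
       measurable_compose[OF measurable_snd measurable_component_singleton])

text \<open>The expected number of collisions is 0. With the parents and cluster \<open>i\<close>
  frozen, cluster \<open>j\<close> would have to contain one of countably many given points, each of
  which it avoids almost surely by \<open>AE_not_daughter\<close>.\<close>

lemma AE_clusters_disjoint:
  "AE \<omega> in M. \<forall>i j. i \<noteq> j \<longrightarrow> (\<forall>y\<in>D i \<omega>. \<forall>y'\<in>D j \<omega>. X i \<omega> + y \<noteq> X j \<omega> + y')"
proof -
  have "AE \<omega> in M. \<forall>y\<in>D i \<omega>. \<forall>y'\<in>D j \<omega>. X i \<omega> + y \<noteq> X j \<omega> + y'" if ij: "i \<noteq> j" for i j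
  proof -
    have meas: "(\<lambda>\<omega>. collisions i j (\<lambda>k. X k \<omega>) (\<lambda>k. D k \<omega>)) \<in> borel_measurable M"
      by (rule measurable_collisions) auto
    have "(\<integral>\<^sup>+\<omega>. collisions i j (\<lambda>k. X k \<omega>) (\<lambda>k. D k \<omega>) \<partial>M) =
       (\<integral>\<^sup>+\<omega>. \<integral>\<^sup>+\<omega>'. collisions i j (\<lambda>k. X k \<omega>) (\<lambda>k. D k \<omega>') \<partial>M \<partial>M)"
      using decouple_parents_daughters[of "\<lambda>p. collisions i j (fst p) (snd p)"]
        measurable_collisions[of fst "Pi\<^sub>M UNIV (\<lambda>_. borel) \<Otimes>\<^sub>M Pi\<^sub>M UNIV (\<lambda>_. cfg_space)" snd i j]
      by simp
    also have "\<dots> = (\<integral>\<^sup>+\<omega>. 0 \<partial>M)"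
    proof (rule nn_integral_cong)
      fix \<omega>0
      let ?x = "\<lambda>k. X k \<omega>0"
      have "(\<integral>\<^sup>+\<omega>. collisions i j ?x (\<lambda>k. D k \<omega>) \<partial>M) =
        (\<integral>\<^sup>+\<omega>. \<integral>\<^sup>+\<omega>'. collisions i j ?x (\<lambda>k. if k = i then D i \<omega> else D k \<omega>') \<partial>M \<partial>M)"
        by (rule decouple_daughter_split, rule measurable_collisions)
           (simp_all add: measurable_split_component)
      also have "\<dots> = (\<integral>\<^sup>+\<omega>. 0 \<partial>M)"
      proof (rule nn_integral_cong)
        fix \<omega> assume \<omega>: "\<omega> \<in> space M"
        let ?c = "\<lambda>y \<omega>'. if (\<forall>k\<in>{j}. \<forall>y'\<in>D k \<omega>'. \<not> dist (?x i + y) (?x k + y') \<le> 0) then 0 else 1 :: ennreal"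
        have mc: "?c y \<in> borel_measurable M" for y
        proof -
          have [measurable]: "Measurable.pred M (\<lambda>\<omega>'. \<forall>k\<in>{j}. \<forall>y'\<in>D k \<omega>'. \<not> dist (?x i + y) (?x k + y') \<le> 0)"
            by (rule measurable_avoid) auto
          show ?thesis by measurable
        qed
        have "(\<integral>\<^sup>+\<omega>'. collisions i j ?x (\<lambda>k. if k = i then D i \<omega> else D k \<omega>') \<partial>M) =
            (\<integral>\<^sup>+\<omega>'. \<integral>\<^sup>+y. ?c y \<omega>' \<partial>count_space (D i \<omega>) \<partial>M)"
          unfolding collisions_def using ij by (intro nn_integral_cong) auto
        also have "\<dots> = (\<integral>\<^sup>+y. \<integral>\<^sup>+\<omega>'. ?c y \<omega>' \<partial>M \<partial>count_space (D i \<omega>))"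
          using lf_configs_countable[OF D.N_lf[OF \<omega>]] mc by (rule nn_integral_count_space_nn_integral)
        also have "\<dots> = (\<integral>\<^sup>+y. 0 \<partial>count_space (D i \<omega>))"
        proof (rule nn_integral_cong)
          fix y
          have "AE \<omega>' in M. ?c y \<omega>' = 0"
            using AE_not_daughter[of "?x i + y - ?x j" j]
          proof eventually_elim
            case (elim \<omega>')
            have "?x i + y \<noteq> ?x j + y'" if "y' \<in> D j \<omega>'" for y'
            proof
              assume "?x i + y = ?x j + y'"
              then have "y' = ?x i + y - ?x j" by (simp add: algebra_simps)
              then show False using elim that by simp
            qed
            then show ?case by simp
          qed
          then have "(\<integral>\<^sup>+\<omega>'. ?c y \<omega>' \<partial>M) = (\<integral>\<^sup>+\<omega>'. 0 \<partial>M)" by (rule nn_integral_cong_AE)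
          then show "(\<integral>\<^sup>+\<omega>'. ?c y \<omega>' \<partial>M) = 0" by simp
        qed
        finally show "(\<integral>\<^sup>+\<omega>'. collisions i j ?x (\<lambda>k. if k = i then D i \<omega> else D k \<omega>') \<partial>M) = 0" by simp
      qed
      finally show "(\<integral>\<^sup>+\<omega>. collisions i j ?x (\<lambda>k. D k \<omega>) \<partial>M) = 0" by simp
    qed
    finally have "AE \<omega> in M. collisions i j (\<lambda>k. X k \<omega>) (\<lambda>k. D k \<omega>) = 0"
      using meas by (simp add: nn_integral_0_iff_AE)
    then show ?thesis
      by eventually_elim (auto simp: collisions_def nn_integral_count_space_eq_0_iff split: if_splits)
  qed
  then show ?thesis by (simp add: AE_all_countable)
qed

text \<open>The expected number of isolated points in the unit window contributed by a parent at
  \<open>a\<close> when the other parents form \<open>\<phi>\<close>; this meaning is established in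
  \<open>expectation_isolated_daughters\<close>.\<close>

definition cluster_kernel :: "real \<Rightarrow> 'a \<Rightarrow> 'a set \<Rightarrow> ennreal" where
  "cluster_kernel r a \<phi> = (\<integral>\<^sup>+y. indicator (ball 0 1) (a + y) * ennreal (exp (- hit r y)) *
     exp_neg (total_hit r (a + y) \<phi>) \<partial>Ld)"

text \<open>With cluster \<open>i\<close> frozen, averaging the other clusters replaces the second
  factor of \<open>isolated_daughters\<close> by the deterministic function \<open>?H\<close> of
  \<open>y\<close>. What is left involves cluster \<open>i\<close> only, and the Mecke formula for
  \<open>D i\<close> evaluates it.\<close>

lemma expectation_isolated_daughters:
  assumes x: "inj x" "range x \<in> lf_configs"
  shows "(\<integral>\<^sup>+\<omega>. isolated_daughters r i x (\<lambda>j. D j \<omega>) \<partial>M) = cluster_kernel r (x i) (x ` (- {i}))"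
proof -
  let ?c = "\<lambda>y \<phi>. if (\<forall>y'\<in>\<phi>. \<not> (y' \<noteq> y \<and> dist y y' \<le> r)) then indicator (ball 0 1) (x i + y) else 0 :: ennreal"
  let ?h = "\<lambda>y \<omega>'. if (\<forall>j\<in>- {i}. \<forall>y'\<in>D j \<omega>'. \<not> dist (x i + y) (x j + y') \<le> r) then 1 else 0 :: ennreal"
  let ?H = "\<lambda>y. exp_neg (total_hit r (x i + y) (x ` (- {i})))"
  have pred: "Measurable.pred M (\<lambda>\<omega>'. \<forall>j\<in>- {i}. \<forall>y'\<in>D j \<omega>'. \<not> dist (x i + y) (x j + y') \<le> r)" for y
    by (rule measurable_avoid) auto
  have mh: "?h y \<in> borel_measurable M" for y
    using pred[of y, measurable] by measurable
  have h_int: "(\<integral>\<^sup>+\<omega>'. ?h y \<omega>' \<partial>M) = ?H y" for y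
  proof -
    let ?E = "{\<omega> \<in> space M. \<forall>j\<in>- {i}. \<forall>y'\<in>D j \<omega>. \<not> dist (x i + y) (x j + y') \<le> r}"
    have "(\<integral>\<^sup>+\<omega>'. ?h y \<omega>' \<partial>M) = (\<integral>\<^sup>+\<omega>'. indicator ?E \<omega>' \<partial>M)"
      by (intro nn_integral_cong) (simp add: indicator_def)
    also have "\<dots> = emeasure M ?E" using pred[of y] by (simp add: pred_def)
    also have "\<dots> = ?H y" by (rule prob_clusters_avoid[OF x])
    finally show ?thesis .
  qed
  have x': "x ` (- {i}) \<in> lf_configs" using x(2) by (rule lf_configs_mono) auto
  have mH[measurable]: "?H \<in> borel_measurable borel"
    by (intro measurable_compose[OF _ measurable_exp_neg] measurable_total_hit) (auto simp: x')
  \<comment> \<open>The clause excluding \<open>y\<close> itself has disappeared: \<open>?F\<close>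
    is meant for the configuration without \<open>y\<close>, the form in which the Mecke formula
    takes it.\<close>
  let ?F = "\<lambda>p. (if (\<forall>y'\<in>snd p. \<not> dist (fst p) y' \<le> r) then indicator (ball 0 1) (x i + fst p) else 0) * ?H (fst p)"
  have "(\<integral>\<^sup>+\<omega>. isolated_daughters r i x (\<lambda>j. D j \<omega>) \<partial>M) =
      (\<integral>\<^sup>+\<omega>. \<integral>\<^sup>+\<omega>'. isolated_daughters r i x (\<lambda>j. if j = i then D i \<omega> else D j \<omega>') \<partial>M \<partial>M)"
    by (rule decouple_daughter_split, rule measurable_isolated_daughters)
       (simp_all add: measurable_split_component)
  also have "\<dots> = (\<integral>\<^sup>+\<omega>. \<integral>\<^sup>+y. ?F (y, D i \<omega> - {y}) \<partial>count_space (D i \<omega>) \<partial>M)"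
  proof (rule nn_integral_cong)
    fix \<omega> assume \<omega>: "\<omega> \<in> space M"
    have "(\<integral>\<^sup>+\<omega>'. isolated_daughters r i x (\<lambda>j. if j = i then D i \<omega> else D j \<omega>') \<partial>M) =
        (\<integral>\<^sup>+\<omega>'. \<integral>\<^sup>+y. ?c y (D i \<omega>) * ?h y \<omega>' \<partial>count_space (D i \<omega>) \<partial>M)"
      unfolding isolated_daughters_def by (intro nn_integral_cong) auto
    also have "\<dots> = (\<integral>\<^sup>+y. \<integral>\<^sup>+\<omega>'. ?c y (D i \<omega>) * ?h y \<omega>' \<partial>M \<partial>count_space (D i \<omega>))"
      using lf_configs_countable[OF D.N_lf[OF \<omega>]]
      by (rule nn_integral_count_space_nn_integral) (intro borel_measurable_times_ennreal mh borel_measurable_const)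
    also have "\<dots> = (\<integral>\<^sup>+y. ?c y (D i \<omega>) * ?H y \<partial>count_space (D i \<omega>))"
      by (intro nn_integral_cong, subst nn_integral_cmult[OF mh]) (simp add: h_int)
    also have "\<dots> = (\<integral>\<^sup>+y. ?F (y, D i \<omega> - {y}) \<partial>count_space (D i \<omega>))"
      by (intro nn_integral_cong) auto
    finally show "(\<integral>\<^sup>+\<omega>'. isolated_daughters r i x (\<lambda>j. if j = i then D i \<omega> else D j \<omega>') \<partial>M) =
      (\<integral>\<^sup>+y. ?F (y, D i \<omega> - {y}) \<partial>count_space (D i \<omega>))" .
  qed
  also have "\<dots> = (\<integral>\<^sup>+y. \<integral>\<^sup>+\<omega>. ?F (y, D i \<omega>) \<partial>M \<partial>Ld)"
  proof (rule D.mecke)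
    have [measurable]: "Measurable.pred (borel \<Otimes>\<^sub>M cfg_space) (\<lambda>p::'a \<times> 'a set. \<forall>y'\<in>snd p. \<not> dist (fst p) y' \<le> r)"
      by (rule measurable_void_pred) measurable
    have [measurable]: "Measurable.pred (borel \<Otimes>\<^sub>M (cfg_space :: 'a set measure)) (\<lambda>p. x i + fst p \<in> ball 0 1)"
      unfolding mem_ball by measurable
    show "?F \<in> borel_measurable (borel \<Otimes>\<^sub>M cfg_space)" by measurable
  qed
  also have "\<dots> = cluster_kernel r (x i) (x ` (- {i}))"
    unfolding cluster_kernel_def
  proof (rule nn_integral_cong)
    fix y
    let ?G = "{\<omega> \<in> space M. D i \<omega> \<inter> cball y r = {}}"
    have "?G = D i -` void_event (cball y r) \<inter> space M"
      using D.N_lf by (auto simp: void_event_def)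
    then have G: "?G \<in> sets M"
      using measurable_sets[OF D.measurable_N void_event_sets[of "cball y r"]] by simp
    have "(\<integral>\<^sup>+\<omega>. ?F (y, D i \<omega>) \<partial>M) = (\<integral>\<^sup>+\<omega>. indicator (ball 0 1) (x i + y) * ?H y * indicator ?G \<omega> \<partial>M)"
      by (intro nn_integral_cong) (auto simp: indicator_def)
    also have "\<dots> = indicator (ball 0 1) (x i + y) * ?H y * emeasure M ?G"
      using G by (rule nn_integral_cmult_indicator)
    also have "emeasure M ?G = ennreal (exp (- hit r y))"
      by (simp add: emeasure_eq_measure daughter_void_prob)
    finally show "(\<integral>\<^sup>+\<omega>. ?F (y, D i \<omega>) \<partial>M) =
        indicator (ball 0 1) (x i + y) * ennreal (exp (- hit r y)) * ?H y"
      by (simp add: mult_ac)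
  qed
  finally show ?thesis .
qed

lemma measurable_cluster_kernel:
  "(\<lambda>p. cluster_kernel r (fst p) (snd p)) \<in> borel_measurable (borel \<Otimes>\<^sub>M cfg_space)"
proof -
  have [measurable]: "(\<lambda>q. total_hit r (fst (fst q) + snd q) (snd (fst q))) \<in>
      borel_measurable ((borel \<Otimes>\<^sub>M cfg_space) \<Otimes>\<^sub>M Ld)"
    by (rule measurable_total_hit) measurable
  have [measurable]: "Measurable.pred ((borel \<Otimes>\<^sub>M cfg_space) \<Otimes>\<^sub>M borel) (\<lambda>q. fst (fst q) + snd q \<in> ball (0::'a) 1)"
    unfolding mem_ball by measurable
  show ?thesis unfolding cluster_kernel_def by measurable
qed

text \<open>The factors separate for two reasons: by stationarity the avoidance probability at
  \<open>a + y\<close> does not depend on the location, and integrating the window over the parent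
  location \<open>a\<close> gives the same volume for every daughter displacement \<open>y\<close>.
  The second point is why the order of integration is reversed.\<close>

lemma expectation_isolated_sum:
  "(\<integral>\<^sup>+\<omega>. (\<Sum>i. isolated_daughters r i (\<lambda>j. X j \<omega>) (\<lambda>j. D j \<omega>)) \<partial>M) =
    avoid_prob r 0 * (\<integral>\<^sup>+y. ennreal (exp (- hit r y)) \<partial>Ld) * emeasure Lp (ball 0 1)"
proof -
  let ?W = "ball (0::'a) 1"
  have "(\<integral>\<^sup>+\<omega>. (\<Sum>i. isolated_daughters r i (\<lambda>j. X j \<omega>) (\<lambda>j. D j \<omega>)) \<partial>M) =
     (\<integral>\<^sup>+\<omega>. \<integral>\<^sup>+\<omega>'. (\<Sum>i. isolated_daughters r i (\<lambda>j. X j \<omega>) (\<lambda>j. D j \<omega>')) \<partial>M \<partial>M)"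
  proof -
    have "(\<lambda>p. \<Sum>i. isolated_daughters r i (fst p) (snd p)) \<in>
       borel_measurable (Pi\<^sub>M UNIV (\<lambda>_. borel) \<Otimes>\<^sub>M Pi\<^sub>M UNIV (\<lambda>_. cfg_space))"
      by (intro borel_measurable_suminf_order measurable_isolated_daughters) auto
    from decouple_parents_daughters[OF this] show ?thesis by simp
  qed
  also have "\<dots> = (\<integral>\<^sup>+\<omega>. \<integral>\<^sup>+a. cluster_kernel r a (P \<omega> - {a}) \<partial>count_space (P \<omega>) \<partial>M)"
  proof (rule nn_integral_cong)
    fix \<omega> assume \<omega>: "\<omega> \<in> space M"
    let ?x = "\<lambda>j. X j \<omega>"
    have inj: "inj ?x" using inj_X[OF \<omega>] .
    have "(\<integral>\<^sup>+\<omega>'. (\<Sum>i. isolated_daughters r i ?x (\<lambda>j. D j \<omega>')) \<partial>M) =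
        (\<Sum>i. \<integral>\<^sup>+\<omega>'. isolated_daughters r i ?x (\<lambda>j. D j \<omega>') \<partial>M)"
      by (intro nn_integral_suminf measurable_isolated_daughters) auto
    also have "\<dots> = (\<Sum>i. cluster_kernel r (?x i) (P \<omega> - {?x i}))"
      using expectation_isolated_daughters[OF inj P.N_lf[OF \<omega>]] image_set_diff[OF inj, of UNIV "{i}" for i]
      by (simp add: Compl_eq_Diff_UNIV)
    \<comment> \<open>Injectivity of the enumeration turns the sum over indices into a sum over
      parent points, each paired with the parent set without it.\<close>
    also have "\<dots> = (\<integral>\<^sup>+i. cluster_kernel r (?x i) (P \<omega> - {?x i}) \<partial>count_space UNIV)"
      by (simp add: nn_integral_count_space_nat)
    also have "\<dots> = (\<integral>\<^sup>+a. cluster_kernel r a (P \<omega> - {a}) \<partial>count_space (P \<omega>))"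
      by (rule nn_integral_bij_count_space) (use inj in \<open>auto simp: bij_betw_def\<close>)
    finally show "(\<integral>\<^sup>+\<omega>'. (\<Sum>i. isolated_daughters r i ?x (\<lambda>j. D j \<omega>')) \<partial>M) =
      (\<integral>\<^sup>+a. cluster_kernel r a (P \<omega> - {a}) \<partial>count_space (P \<omega>))" .
  qed
  also have "\<dots> = (\<integral>\<^sup>+a. \<integral>\<^sup>+\<omega>. cluster_kernel r a (P \<omega>) \<partial>M \<partial>Lp)"
    using P.mecke[OF measurable_cluster_kernel] by simp
  also have "\<dots> = (\<integral>\<^sup>+a. \<integral>\<^sup>+y. indicator ?W (a + y) * ennreal (exp (- hit r y)) * avoid_prob r 0 \<partial>Ld \<partial>Lp)"
  proof (rule nn_integral_cong)
    fix a
    interpret pair_sigma_finite Ld M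
      by (intro pair_sigma_finite.intro Ld.sigma_finite_measure_axioms sigma_finite_measure_axioms)
    have [measurable]: "(\<lambda>q. total_hit r (a + fst q) (P (snd q))) \<in> borel_measurable (Ld \<Otimes>\<^sub>M M)"
      by (rule measurable_total_hit) measurable
    have [measurable]: "(\<lambda>\<omega>. total_hit r (a + y) (P \<omega>)) \<in> borel_measurable M" for y
      by (rule measurable_total_hit) measurable
    have "(\<integral>\<^sup>+\<omega>. cluster_kernel r a (P \<omega>) \<partial>M) =
       (\<integral>\<^sup>+y. \<integral>\<^sup>+\<omega>. indicator ?W (a + y) * ennreal (exp (- hit r y)) * exp_neg (total_hit r (a + y) (P \<omega>)) \<partial>M \<partial>Ld)"
    proof -
      have [measurable]: "Measurable.pred (borel \<Otimes>\<^sub>M M) (\<lambda>q. a + fst q \<in> ?W)"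
        unfolding mem_ball by measurable
      show ?thesis unfolding cluster_kernel_def by (rule Fubini') measurable
    qed
    also have "\<dots> = (\<integral>\<^sup>+y. indicator ?W (a + y) * ennreal (exp (- hit r y)) * avoid_prob r 0 \<partial>Ld)"
      by (intro nn_integral_cong, subst nn_integral_cmult)
         (auto simp: avoid_prob_def[symmetric] avoid_prob_stationary[of r "a + y" for y])
    finally show "(\<integral>\<^sup>+\<omega>. cluster_kernel r a (P \<omega>) \<partial>M) =
       (\<integral>\<^sup>+y. indicator ?W (a + y) * ennreal (exp (- hit r y)) * avoid_prob r 0 \<partial>Ld)" .
  qed
  also have "\<dots> = (\<integral>\<^sup>+y. \<integral>\<^sup>+a. indicator ?W (a + y) * ennreal (exp (- hit r y)) * avoid_prob r 0 \<partial>Lp \<partial>Ld)"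
  proof -
    interpret pair_sigma_finite Ld Lp
      by (intro pair_sigma_finite.intro Ld.sigma_finite_measure_axioms Lp.sigma_finite_measure_axioms)
    have [measurable]: "Measurable.pred (borel \<Otimes>\<^sub>M borel) (\<lambda>q. snd q + fst q \<in> ?W)"
      unfolding mem_ball by measurable
    show ?thesis by (rule Fubini') measurable
  qed
  also have "\<dots> = (\<integral>\<^sup>+y. ennreal (exp (- hit r y)) * (avoid_prob r 0 * emeasure Lp ?W) \<partial>Ld)"
  proof (rule nn_integral_cong)
    fix y
    have "(\<integral>\<^sup>+a. indicator ?W (a + y) \<partial>Lp) = (\<integral>\<^sup>+a. indicator (ball (- y) 1) a \<partial>Lp)"
      by (intro nn_integral_cong) (auto simp: indicator_def dist_norm norm_minus_commute add.commute)
    also have "\<dots> = emeasure Lp (ball (- y) 1)" by simp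
    also have "\<dots> = emeasure Lp ?W"
      using emeasure_ball_center[of "- y" 1 0] by (simp add: emeasure_scaled_lebesgue)
    finally have shift: "(\<integral>\<^sup>+a. indicator ?W (a + y) \<partial>Lp) = emeasure Lp ?W" .
    have [measurable]: "Measurable.pred borel (\<lambda>a. a + y \<in> ?W)"
      unfolding mem_ball by measurable
    have "(\<integral>\<^sup>+a. indicator ?W (a + y) * ennreal (exp (- hit r y)) * avoid_prob r 0 \<partial>Lp) =
        (\<integral>\<^sup>+a. (ennreal (exp (- hit r y)) * avoid_prob r 0) * indicator ?W (a + y) \<partial>Lp)"
      by (simp add: mult_ac)
    also have "\<dots> = (ennreal (exp (- hit r y)) * avoid_prob r 0) * (\<integral>\<^sup>+a. indicator ?W (a + y) \<partial>Lp)"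
      by (rule nn_integral_cmult) measurable
    finally show "(\<integral>\<^sup>+a. indicator ?W (a + y) * ennreal (exp (- hit r y)) * avoid_prob r 0 \<partial>Lp) =
        ennreal (exp (- hit r y)) * (avoid_prob r 0 * emeasure Lp ?W)"
      by (simp add: shift mult_ac)
  qed
  also have "\<dots> = (\<integral>\<^sup>+y. ennreal (exp (- hit r y)) \<partial>Ld) * (avoid_prob r 0 * emeasure Lp ?W)"
    by (rule nn_integral_multc) measurable
  finally show ?thesis by (simp add: mult_ac)
qed

end

section \<open>From enumerated clusters back to the points of the process\<close>

lemma nn_integral_count_space_UN_disjoint:
  fixes f :: "'a \<Rightarrow> ennreal" and A :: "nat \<Rightarrow> 'a set"
  assumes "disjoint_family A"
  shows "(\<integral>\<^sup>+x. f x \<partial>count_space (\<Union>i. A i)) = (\<Sum>i. \<integral>\<^sup>+x. f x \<partial>count_space (A i))"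
proof -
  have "(\<integral>\<^sup>+x. f x \<partial>count_space (\<Union>i. A i)) = (\<integral>\<^sup>+x. f x * indicator (\<Union>i. A i) x \<partial>count_space UNIV)"
    by (subst nn_integral_count_space_indicator) auto
  also have "\<dots> = (\<integral>\<^sup>+x. (\<Sum>i. f x * indicator (A i) x) \<partial>count_space UNIV)"
    using suminf_indicator[OF assms] by (simp add: ennreal_suminf_cmult)
  also have "\<dots> = (\<Sum>i. \<integral>\<^sup>+x. f x * indicator (A i) x \<partial>count_space UNIV)"
    by (rule nn_integral_suminf) simp
  also have "\<dots> = (\<Sum>i. \<integral>\<^sup>+x. f x \<partial>count_space (A i))"
    by (intro suminf_cong, subst (2) nn_integral_count_space_indicator) auto
  finally show ?thesis .
qed

context cluster_process
begin

text \<open>A pathwise identity, valid on the almost sure event that daughters stay in their ball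
  and clusters are disjoint: then each point of \<open>Phi \<omega>\<close> arises from exactly one
  pair of a parent and a daughter.\<close>

lemma isolated_points_eq:
  assumes \<omega>: "\<omega> \<in> space M" and ball: "\<forall>i. D i \<omega> \<subseteq> ball 0 rd"
    and disj: "\<forall>i j. i \<noteq> j \<longrightarrow> (\<forall>y\<in>D i \<omega>. \<forall>y'\<in>D j \<omega>. X i \<omega> + y \<noteq> X j \<omega> + y')"
  shows "(\<Sum>x\<in>Phi \<omega> \<inter> ball 0 1. indicator {\<phi>. \<phi> \<inter> cball 0 r = {}} ((\<lambda>z. z - x) ` (Phi \<omega> - {x}))) =
    (\<Sum>i. isolated_daughters r i (\<lambda>j. X j \<omega>) (\<lambda>j. D j \<omega>))"
proof -
  let ?W = "ball (0::'a) 1"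
  let ?A = "\<lambda>i. (\<lambda>y. X i \<omega> + y) ` D i \<omega>"
  let ?h = "\<lambda>x. indicator {\<phi>. \<phi> \<inter> cball 0 r = {}} ((\<lambda>z. z - x) ` (Phi \<omega> - {x})) :: ennreal"
  have Phi_eq: "Phi \<omega> = (\<Union>i. ?A i)" by (rule Phi[OF \<omega>])
  \<comment> \<open>A sum over an infinite set would be 0 by convention. Only parents within
    \<open>1 + rd\<close> of the origin reach the window; they are finitely many, with finitely many
    daughters each.\<close>
  have fin: "finite (Phi \<omega> \<inter> ?W)"
  proof -
    define I where "I = {i. X i \<omega> \<in> ball 0 (1 + rd)}"
    have "finite ((\<lambda>i. X i \<omega>) ` I)"
      using P.finite_N[OF \<omega>, of "ball 0 (1 + rd)"]
      by (rule finite_subset[rotated]) (auto simp: I_def)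
    then have "finite I" using inj_X[OF \<omega>] by (auto dest: finite_imageD intro: inj_on_subset)
    have "finite (D i \<omega>)" for i
    proof -
      have "D i \<omega> = D i \<omega> \<inter> ball 0 rd" using ball by blast
      then show ?thesis using D.finite_N[OF \<omega>, of "ball 0 rd" i] by simp
    qed
    then have "finite (\<Union>i\<in>I. ?A i)" using \<open>finite I\<close> by blast
    moreover have "Phi \<omega> \<inter> ?W \<subseteq> (\<Union>i\<in>I. ?A i)"
    proof
      fix z assume z: "z \<in> Phi \<omega> \<inter> ?W"
      then obtain i y where y: "y \<in> D i \<omega>" "z = X i \<omega> + y" unfolding Phi_eq by blast
      have "norm y < rd" using ball y(1) by (auto simp: subset_iff)
      moreover have "norm (X i \<omega> + y) < 1" using z y(2) by simp
      ultimately have "norm (X i \<omega>) < 1 + rd"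
        using norm_triangle_ineq4[of "X i \<omega> + y" y] by simp
      then show "z \<in> (\<Union>i\<in>I. ?A i)" using y by (auto simp: I_def)
    qed
    ultimately show ?thesis by (rule finite_subset[rotated])
  qed
  have term_eq: "?h x * indicator ?W x =
      (if (\<forall>y'\<in>D i \<omega>. \<not> (y' \<noteq> y \<and> dist y y' \<le> r)) then indicator ?W (X i \<omega> + y) else 0) *
      (if (\<forall>j\<in>- {i}. \<forall>y'\<in>D j \<omega>. \<not> dist (X i \<omega> + y) (X j \<omega> + y') \<le> r) then 1 else 0)"
    if y: "y \<in> D i \<omega>" and x: "x = X i \<omega> + y" for x i y
  proof -
    have "(\<lambda>z. z - x) ` (Phi \<omega> - {x}) \<inter> cball 0 r = {} \<longleftrightarrow>
        (\<forall>z\<in>Phi \<omega>. z \<noteq> x \<longrightarrow> \<not> dist x z \<le> r)"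
      by (auto simp: dist_norm norm_minus_commute disjoint_iff)
    also have "\<dots> \<longleftrightarrow> (\<forall>j. \<forall>y'\<in>D j \<omega>. X j \<omega> + y' \<noteq> x \<longrightarrow> \<not> dist x (X j \<omega> + y') \<le> r)"
      unfolding Phi_eq by blast
    also have "\<dots> \<longleftrightarrow> (\<forall>y'\<in>D i \<omega>. \<not> (y' \<noteq> y \<and> dist y y' \<le> r)) \<and>
        (\<forall>j\<in>- {i}. \<forall>y'\<in>D j \<omega>. \<not> dist x (X j \<omega> + y') \<le> r)" (is "?l \<longleftrightarrow> ?r1 \<and> ?r2")
    proof (intro iffI conjI)
      assume l: ?l
      show ?r1
      proof (intro ballI notI)
        fix y' assume y': "y' \<in> D i \<omega>" "y' \<noteq> y \<and> dist y y' \<le> r"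
        then have "X i \<omega> + y' \<noteq> x" "dist x (X i \<omega> + y') \<le> r" by (auto simp: x)
        then show False using l y'(1) by blast
      qed
      show ?r2
      proof (intro ballI)
        fix j y' assume j: "j \<in> - {i}" "y' \<in> D j \<omega>"
        \<comment> \<open>Disjointness of clusters makes the exclusion of \<open>x\<close> itself
          automatic here, which is why the second factor carries no such clause.\<close>
        then have "X j \<omega> + y' \<noteq> x" using disj y unfolding x by (metis ComplD singletonI)
        then show "\<not> dist x (X j \<omega> + y') \<le> r" using l j(2) by blast
      qed
    next
      assume r: "?r1 \<and> ?r2"
      show ?l
      proof (intro allI ballI impI)
        fix j y' assume y': "y' \<in> D j \<omega>" "X j \<omega> + y' \<noteq> x"
        show "\<not> dist x (X j \<omega> + y') \<le> r"
        proof (cases "j = i")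
          case True
          then have "y' \<in> D i \<omega>" "y' \<noteq> y" using y' x by auto
          then have "\<not> dist y y' \<le> r" using r by blast
          then show ?thesis by (simp add: x True)
        next
          case False
          then show ?thesis using r y'(1) by blast
        qed
      qed
    qed
    finally show ?thesis unfolding x indicator_def by auto
  qed
  have "(\<Sum>x\<in>Phi \<omega> \<inter> ?W. ?h x) = (\<integral>\<^sup>+x. ?h x * indicator ?W x \<partial>count_space (Phi \<omega>))"
    by (rule nn_integral_count_space_finite_indicator[OF fin, symmetric])
  also have "\<dots> = (\<Sum>i. \<integral>\<^sup>+x. ?h x * indicator ?W x \<partial>count_space (?A i))"
  proof -
    have "?A i \<inter> ?A j = {}" if "i \<noteq> j" for i j
      using disj that by fast
    then have "disjoint_family ?A" by (simp add: disjoint_family_on_def)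
    then show ?thesis unfolding Phi_eq by (rule nn_integral_count_space_UN_disjoint)
  qed
  also have "\<dots> = (\<Sum>i. isolated_daughters r i (\<lambda>j. X j \<omega>) (\<lambda>j. D j \<omega>))"
  proof (rule suminf_cong)
    fix i
    have "(\<integral>\<^sup>+x. ?h x * indicator ?W x \<partial>count_space (?A i)) =
        (\<integral>\<^sup>+y. ?h (X i \<omega> + y) * indicator ?W (X i \<omega> + y) \<partial>count_space (D i \<omega>))"
      by (rule nn_integral_bij_count_space[symmetric]) (auto simp: bij_betw_def inj_on_def)
    also have "\<dots> = isolated_daughters r i (\<lambda>j. X j \<omega>) (\<lambda>j. D j \<omega>)"
      unfolding isolated_daughters_def by (rule nn_integral_cong, rule term_eq) auto
    finally show "(\<integral>\<^sup>+x. ?h x * indicator ?W x \<partial>count_space (?A i)) =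
        isolated_daughters r i (\<lambda>j. X j \<omega>) (\<lambda>j. D j \<omega>)" .
  qed
  finally show ?thesis .
qed

lemma expectation_isolated_points:
  "(\<integral>\<^sup>+\<omega>. (\<Sum>x\<in>Phi \<omega> \<inter> ball 0 1. indicator {\<phi>. \<phi> \<inter> cball 0 r = {}} ((\<lambda>z. z - x) ` (Phi \<omega> - {x}))) \<partial>M) =
    avoid_prob r 0 * (\<integral>\<^sup>+y. ennreal (exp (- hit r y)) \<partial>Ld) * emeasure Lp (ball 0 1)"
proof -
  have "AE \<omega> in M. (\<Sum>x\<in>Phi \<omega> \<inter> ball 0 1. indicator {\<phi>. \<phi> \<inter> cball 0 r = {}} ((\<lambda>z. z - x) ` (Phi \<omega> - {x})) :: ennreal) =
      (\<Sum>i. isolated_daughters r i (\<lambda>j. X j \<omega>) (\<lambda>j. D j \<omega>))"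
    using AE_daughters_in_ball AE_clusters_disjoint AE_space
  proof eventually_elim
    case (elim \<omega>)
    show ?case by (rule isolated_points_eq[OF elim(3,1,2)])
  qed
  then show ?thesis by (subst nn_integral_cong_AE) (auto simp: expectation_isolated_sum)
qed

lemma avoid_prob_eq_contact_cdf: "avoid_prob r 0 = ennreal (1 - contact_cdf M Phi r)"
proof -
  let ?E = "{\<omega> \<in> space M. \<forall>i. \<forall>y\<in>D i \<omega>. \<not> dist 0 (X i \<omega> + y) \<le> r}"
  have "(\<exists>z\<in>Phi \<omega>. norm z \<le> r) \<longleftrightarrow> (\<exists>i. \<exists>y\<in>D i \<omega>. dist 0 (X i \<omega> + y) \<le> r)" if "\<omega> \<in> space M" for \<omega>
    unfolding Phi[OF that] by simp
  then have "{\<omega> \<in> space M. \<exists>z\<in>Phi \<omega>. norm z \<le> r} = space M - ?E" by (intro set_eqI) (simp cong: conj_cong)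
  then have "contact_cdf M Phi r = 1 - prob ?E"
    unfolding contact_cdf_def using prob_compl[OF prob_no_point_near(1)[of 0 r]] by simp
  then show ?thesis using prob_no_point_near(2)[of 0 r] by (simp add: emeasure_eq_measure)
qed

text \<open>The Palm probability is a quotient of two expectations in which \<open>lp\<close>,
  \<open>ld\<close> and the window volume cancel. The polar density contributes dimension times unit
  ball volume to the numerator and the mean cluster size contributes unit ball volume times
  \<open>rd ^ DIM('a)\<close> to the denominator, whence the constant
  \<open>DIM('a) / rd ^ DIM('a)\<close>.\<close>

theorem nn_dist_cdf_eq:
  "nn_dist_cdf M Phi r = 1 - (1 - contact_cdf M Phi r) * (real DIM('a) / rd ^ DIM('a) *
      integral {0..rd} (\<lambda>x. exp (- ld * lens_vol TYPE('a) r rd x) * x ^ (DIM('a) - 1)))"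
proof -
  let ?n = "real DIM('a)"
  let ?v = "unit_ball_vol ?n"
  let ?I = "integral {0..rd} (\<lambda>x. exp (- ld * lens_vol TYPE('a) r rd x) * x ^ (DIM('a) - 1))"
  let ?g = "1 - contact_cdf M Phi r"
  have v: "0 < ?v" by simp
  have g: "0 \<le> ?g" by (simp add: contact_cdf_def)
  \<comment> \<open>Signs matter because \<open>ennreal\<close> truncates negative numbers, so
    products may be merged under it only for nonnegative factors.\<close>
  have I: "0 \<le> ?I"
  proof (cases "(\<lambda>x. exp (- ld * lens_vol TYPE('a) r rd x) * x ^ (DIM('a) - 1)) integrable_on {0..rd}")
    case True
    then show ?thesis by (rule integral_nonneg) auto
  next
    case False
    then show ?thesis by (simp add: not_integrable_integral)
  qed
  have Lp_W: "emeasure Lp (ball 0 1) = ennreal (lp * ?v)"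
    using lp by (simp add: emeasure_scaled_lebesgue emeasure_ball ennreal_mult')
  have Ld_ball: "emeasure Ld UNIV = ennreal (ld * (?v * rd ^ DIM('a)))"
    using ld rd by (simp add: emeasure_scaled_lebesgue emeasure_ball ennreal_mult')
  have "(\<integral>\<^sup>+y. ennreal (exp (- hit r y)) \<partial>Ld) =
      ennreal ld * (\<integral>\<^sup>+y. ennreal (exp (- hit r y)) * indicator (ball 0 rd) y \<partial>lborel)"
    by (rule nn_integral_scaled_lebesgue) measurable
  also have "\<dots> = ennreal ld * ennreal (?n * ?v * ?I)"
    using nn_integral_ball_lens[of ld rd r, where 'a='a] ld rd by (simp add: hit_eq)
  finally have Ld_int: "(\<integral>\<^sup>+y. ennreal (exp (- hit r y)) \<partial>Ld) = ennreal (ld * (?n * ?v * ?I))"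
    using ld I by (simp add: ennreal_mult')
  have num: "(\<integral>\<^sup>+\<omega>. (\<Sum>x\<in>Phi \<omega> \<inter> ball 0 1. indicator {\<phi>. \<phi> \<inter> cball 0 r = {}} ((\<lambda>z. z - x) ` (Phi \<omega> - {x}))) \<partial>M) =
      ennreal (?g * (ld * (?n * ?v * ?I)) * (lp * ?v))"
    unfolding expectation_isolated_points avoid_prob_eq_contact_cdf Ld_int Lp_W
    using g ld lp I by (simp flip: ennreal_mult)
  have den: "(\<integral>\<^sup>+\<omega>. ennreal (real (card (Phi \<omega> \<inter> ball 0 1))) \<partial>M) = ennreal (ld * (?v * rd ^ DIM('a)) * (lp * ?v))"
  proof -
    \<comment> \<open>For a negative radius every point is isolated, so the denominator is an instance of the numerator.\<close>
    have hit0: "hit (-1) y = 0" for y by (simp add: hit_def)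
    have "avoid_prob (-1) 0 = 1"
      by (simp add: avoid_prob_def total_hit_def hit0 exp_neg_def emeasure_space_1)
    moreover have "(\<integral>\<^sup>+y. ennreal (exp (- hit (-1) y)) \<partial>Ld) = emeasure Ld UNIV"
      by (simp add: hit0)
    moreover have "ennreal (real (card (Phi \<omega> \<inter> ball 0 1))) =
        (\<Sum>x\<in>Phi \<omega> \<inter> ball 0 1. indicator {\<phi>. \<phi> \<inter> cball 0 (-1) = {}} ((\<lambda>z. z - x) ` (Phi \<omega> - {x})))" for \<omega>
      by (simp add: ennreal_of_nat_eq_real_of_nat)
    ultimately show ?thesis
      using expectation_isolated_points[of "-1"] ld rd lp
      by (simp add: Ld_ball Lp_W flip: ennreal_mult)
  qed
  have "reduced_palm_prob M Phi {\<phi>. \<phi> \<inter> cball 0 r = {}} =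
      (?g * (ld * (?n * ?v * ?I)) * (lp * ?v)) / (ld * (?v * rd ^ DIM('a)) * (lp * ?v))"
    unfolding reduced_palm_prob_def num den
    using g ld lp rd I v by (subst divide_ennreal) auto
  also have "\<dots> = ?g * (?n / rd ^ DIM('a) * ?I)"
  proof -
    have "(a * (ld * (b * v * c)) * (lp * v)) / (ld * (v * d) * (lp * v)) = a * (b / d * c)"
      if "v > 0" "d > 0" for a b c d v :: real
      using that ld lp by (simp add: divide_simps)
    then show ?thesis using v rd by simp
  qed
  finally show ?thesis unfolding nn_dist_cdf_def by simp
qed

end

theorem theorem4:
  fixes M :: "'w measure" and Phi :: "'w \<Rightarrow> 'a::euclidean_space set"
    and lp ld rd r :: real
  assumes "lp > 0" and "ld > 0" and "rd > 0"
    and "matern_cluster M Phi lp ld rd"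
    and "r > 0"
  shows "nn_dist_cdf M Phi r =
    1 - (1 - contact_cdf M Phi r) * (real DIM('a) / rd ^ DIM('a) *
      integral {0..rd} (\<lambda>x. exp (- ld * lens_vol TYPE('a) r rd x) * x ^ (DIM('a) - 1)))"
proof -
  have "\<exists>X D. cluster_process M X D Phi lp ld rd"
    using assms(4) unfolding matern_cluster_def cluster_process_def cluster_process_axioms_def
    by (simp only: assms(1-3) Ball_def simp_thms conj_assoc)
  then obtain X D where "cluster_process M X D Phi lp ld rd" by (elim exE)
  then interpret cluster_process M X D Phi lp ld rd .
  show ?thesis by (rule nn_dist_cdf_eq)
qed

end
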